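(* Suppose $\alpha,\beta\in(0,1)$, $0<\alpha+\beta<1$, $c_1\le n_1/n_2\le c_2$ for some constants $c_1,c_2>0$, $\beta<1/e$ and $B\ge2\alpha^{-2}\log(6/\beta)$. The uniform separation rate of the two-sample permutation test $\widehat\psi_{\nu,n,2}(\alpha)$ satisfies $$\rho\{\widehat\psi_{\nu,n,2}(\alpha),\beta\}=\inf\Big\{\rho>0:\sup_{\nu\in\mathcal V}\sup_{(\mathbb P^X,\mathbb P^Y)\in\mathcal F_\nu(\rho)}\mathrm P\big(\widehat\psi_{\nu,n,2}(\alpha)=0\big)\le\beta\Big\}\le c\,(n_1+n_2)^{-1/2}\{\log(\alpha^{-1})+\log(\beta^{-1})\},$$ where $c>0$ is an absolute constant. Moreover, for given $\alpha,\beta$ with $0<\alpha+\beta<1$, the minimax separation rate satisfies $$\rho^*(\alpha,\beta)=\inf_{\psi_\alpha\in\Psi(\alpha)}\rho(\psi_\alpha,\beta)\ge c'(n_1+n_2)^{-1/2}$$ for some absolute constant $c'>0$.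
   Context: $\mathcal H$ is a real separable infinite-dimensional Hilbert space with inner product $\langle\cdot,\cdot\rangle$; $\mathcal V$ is the set of Borel probability measures $\nu$ on $\mathcal H$ that are symmetric ($\nu(B)=\nu(-B)$ for all Borel $B$) with $\operatorname{supp}(\nu)=\mathcal H$; $\varphi_\nu(w)=\int_{\mathcal H}\exp(\mathrm i\langle w,z\rangle)\nu(\mathrm dz)$. The data are independent $\mathcal H$-valued observations $X_1,\dots,X_{n_1}$ i.i.d. with law $\mathbb P^X$ and $Y_1,\dots,Y_{n_2}$ i.i.d. with law $\mathbb P^Y$; one tests $H_0:\mathbb P^X=\mathbb P^Y$ against $H_1:\mathbb P^X\ne\mathbb P^Y$. With $\varphi_X(w)=\mathbb E e^{\mathrm i\langle X,w\rangle}$ and $\varphi_Y(w)=\mathbb E e^{\mathrm i\langle Y,w\rangle}$, let $\mathcal F_\nu(\rho)=\{(\mathbb P^X,\mathbb P^Y):\int_{\mathcal H}|\varphi_X-\varphi_Y|^2\,\mathrm d\nu\ge\rho\}$. Let $(Z_1,\dots,Z_{n_1+n_2})=(X_1,\dots,X_{n_1},Y_1,\dots,Y_{n_2})$ and, for $1\le j,k\le n_1+n_2$, $$Q_{j,k}=\frac{\mathbf 1\{1\le j,k\le n_1\}}{n_1}+\frac{\mathbf 1\{n_1+1\le j,k\le n_1+n_2\}}{n_2}-\frac1{n_1+n_2}.$$ Set $\operatorname{Ed}_\nu^2(\widehat{\mathbb P}^X,\widehat{\mathbb P}^Y)=\frac{n_1+n_2}{n_1n_2}\sum_{j,k=1}^{n_1+n_2}\varphi_\nu(Z_j-Z_k)Q_{j,k}$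 and, for a permutation $\Pi$ of $(1,\dots,n_1+n_2)$, $\operatorname{Ed}_\nu^2(\widehat{\mathbb P}^X,\widehat{\mathbb P}^Y,\Pi)=\frac{n_1+n_2}{n_1n_2}\sum_{j,k=1}^{n_1+n_2}\varphi_\nu(Z_{\Pi(j)}-Z_{\Pi(k)})Q_{j,k}$. With $\Pi_1,\dots,\Pi_B$ i.i.d. uniform random permutations of $(1,\dots,n_1+n_2)$ independent of the data, the test (value $1$ = rejection) is $$\widehat\psi_{\nu,n,2}(\alpha)=\mathbf 1\Big\{\frac1B\sum_{b=1}^B\mathbf 1\big\{\operatorname{Ed}_\nu^2(\widehat{\mathbb P}^X,\widehat{\mathbb P}^Y,\Pi_b)<\operatorname{Ed}_\nu^2(\widehat{\mathbb P}^X,\widehat{\mathbb P}^Y)\big\}>1-\alpha\Big\}.$$ $\Psi$ is the set of all non-randomized tests ($\{0,1\}$-valued measurable functions of the data), $\Psi(\alpha)=\{\psi\in\Psi:\sup\mathrm P(\psi=1)\le\alpha\}$, the supremum being over all $(\mathbb P^X,\mathbb P^Y)$ with $\mathbb P^X=\mathbb P^Y$, and $\rho(\psi,\beta)=\inf\{\rho>0:\sup_{\nu\in\mathcal V}\sup_{(\mathbb P^X,\mathbb P^Y)\in\mathcal F_\nu(\rho)}\mathrm P(\psi=0)\le\beta\}$. *)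

theory Defs
  imports "HOL-Probability.Probability"
begin

text \<open>The Hilbert space is a type of class \<open>{real_inner, polish_space}\<close>: a complete, separable
  real inner product space. Being infinite-dimensional is a hypothesis of the theorem.\<close>

definition borel_prob :: "'a::topological_space measure set" where
  "borel_prob = {P. prob_space P \<and> sets P = sets borel}"

definition measure_support :: "'a::topological_space measure \<Rightarrow> 'a set" where
  "measure_support \<nu> = {x. \<forall>U. open U \<and> x \<in> U \<longrightarrow> 0 < emeasure \<nu> U}"

definition weighting_measures :: "'a::{real_inner, polish_space} measure set" where
  "weighting_measures =
     {\<nu> \<in> borel_prob. (\<forall>A \<in> sets borel. emeasure \<nu> A = emeasure \<nu> (uminus ` A)) \<and>
        measure_support \<nu> = UNIV}"

definition char_fun :: "'a::{real_inner, polish_space} measure \<Rightarrow> 'a \<Rightarrow> complex" where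
  "char_fun P w = (LINT z|P. exp (\<i> * complex_of_real (w \<bullet> z)))"

definition alternatives ::
  "'a::{real_inner, polish_space} measure \<Rightarrow> real \<Rightarrow> ('a measure \<times> 'a measure) set" where
  "alternatives \<nu> \<rho> =
     {(P, Q). P \<in> borel_prob \<and> Q \<in> borel_prob \<and>
        (LINT w|\<nu>. (cmod (char_fun P w - char_fun Q w))\<^sup>2) \<ge> \<rho>}"

text \<open>The pooled sample is a function \<open>z\<close> on the indices \<open>1, \<dots>, n1 + n2\<close>: the observations
  \<open>z 1, \<dots>, z n1\<close> are the first sample and the remaining ones are the second sample.\<close>

definition data_law ::
  "nat \<Rightarrow> nat \<Rightarrow> 'a::{real_inner, polish_space} measure \<Rightarrow> 'a measure \<Rightarrow> (nat \<Rightarrow> 'a) measure" where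
  "data_law n1 n2 P Q = PiM {1..n1 + n2} (\<lambda>j. if j \<le> n1 then P else Q)"

definition perms_law :: "nat \<Rightarrow> nat \<Rightarrow> (nat \<Rightarrow> nat \<Rightarrow> nat) measure" where
  "perms_law n B = PiM {1..B} (\<lambda>b. uniform_count_measure {p. p permutes {1..n}})"

definition Q_weight :: "nat \<Rightarrow> nat \<Rightarrow> nat \<Rightarrow> nat \<Rightarrow> real" where
  "Q_weight n1 n2 j k =
     indicator ({1..n1} \<times> {1..n1}) (j, k) / real n1
     + indicator ({n1 + 1..n1 + n2} \<times> {n1 + 1..n1 + n2}) (j, k) / real n2
     - 1 / real (n1 + n2)"

text \<open>For symmetric \<open>\<nu>\<close> the function \<open>char_fun \<nu>\<close> is real-valued, so that taking the real part
  does not change the statistic and only makes the order comparison below possible.\<close>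

definition Ed2 ::
  "'a::{real_inner, polish_space} measure \<Rightarrow> nat \<Rightarrow> nat \<Rightarrow> (nat \<Rightarrow> 'a) \<Rightarrow> real" where
  "Ed2 \<nu> n1 n2 z =
     real (n1 + n2) / (real n1 * real n2) *
     (\<Sum>j\<in>{1..n1 + n2}. \<Sum>k\<in>{1..n1 + n2}. Re (char_fun \<nu> (z j - z k)) * Q_weight n1 n2 j k)"

definition Ed2_perm ::
  "'a::{real_inner, polish_space} measure \<Rightarrow> nat \<Rightarrow> nat \<Rightarrow> (nat \<Rightarrow> 'a) \<Rightarrow> (nat \<Rightarrow> nat) \<Rightarrow> real" where
  "Ed2_perm \<nu> n1 n2 z p =
     real (n1 + n2) / (real n1 * real n2) *
     (\<Sum>j\<in>{1..n1 + n2}. \<Sum>k\<in>{1..n1 + n2}. Re (char_fun \<nu> (z (p j) - z (p k))) * Q_weight n1 n2 j k)"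

text \<open>Tests take the value 1 for rejection of the null hypothesis and 0 otherwise.\<close>

definition perm_test ::
  "nat \<Rightarrow> nat \<Rightarrow> nat \<Rightarrow> real \<Rightarrow> 'a::{real_inner, polish_space} measure \<Rightarrow>
   (nat \<Rightarrow> 'a) \<Rightarrow> (nat \<Rightarrow> nat \<Rightarrow> nat) \<Rightarrow> nat" where
  "perm_test n1 n2 B \<alpha> \<nu> z ps =
     (if 1 / real B * (\<Sum>b\<in>{1..B}. (if Ed2_perm \<nu> n1 n2 z (ps b) < Ed2 \<nu> n1 n2 z then 1 else 0)) > 1 - \<alpha>
      then 1 else 0)"

definition tests :: "nat \<Rightarrow> nat \<Rightarrow> ((nat \<Rightarrow> 'a::{real_inner, polish_space}) \<Rightarrow> nat) set" where
  "tests n1 n2 = measurable (PiM {1..n1 + n2} (\<lambda>_. borel)) (count_space {0, 1})"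

definition level_tests ::
  "nat \<Rightarrow> nat \<Rightarrow> real \<Rightarrow> ((nat \<Rightarrow> 'a::{real_inner, polish_space}) \<Rightarrow> nat) set" where
  "level_tests n1 n2 \<alpha> =
     {\<psi> \<in> tests n1 n2.
        (SUP P \<in> borel_prob.
           emeasure (data_law n1 n2 P P) {z \<in> space (data_law n1 n2 P P). \<psi> z = 1}) \<le> ennreal \<alpha>}"

text \<open>The argument \<open>err \<nu> P Q\<close> is the probability of a type II error under the laws \<open>P\<close> and \<open>Q\<close>. It
  depends on \<open>\<nu>\<close> because the permutation test does; for a single test \<open>\<psi>\<close> it does not. Suprema are
  taken in \<^typ>\<open>ennreal\<close> and infima in \<^typ>\<open>ereal\<close>, where the supremum over the empty set is 0 and the
  infimum over the empty set is infinite.\<close>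

definition separation_rate ::
  "('a::{real_inner, polish_space} measure \<Rightarrow> 'a measure \<Rightarrow> 'a measure \<Rightarrow> ennreal) \<Rightarrow> real \<Rightarrow> ereal" where
  "separation_rate err \<beta> =
     (INF \<rho> \<in> {\<rho>::real. 0 < \<rho> \<and>
                 (SUP \<nu> \<in> weighting_measures. SUP (P, Q) \<in> alternatives \<nu> \<rho>. err \<nu> P Q) \<le> ennreal \<beta>}.
        ereal \<rho>)"

definition test_error ::
  "nat \<Rightarrow> nat \<Rightarrow> ((nat \<Rightarrow> 'a::{real_inner, polish_space}) \<Rightarrow> nat) \<Rightarrow>
   'a measure \<Rightarrow> 'a measure \<Rightarrow> ennreal" where
  "test_error n1 n2 \<psi> P Q =
     emeasure (data_law n1 n2 P Q) {z \<in> space (data_law n1 n2 P Q). \<psi> z = 0}"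

definition perm_test_error ::
  "nat \<Rightarrow> nat \<Rightarrow> nat \<Rightarrow> real \<Rightarrow> 'a::{real_inner, polish_space} measure \<Rightarrow>
   'a measure \<Rightarrow> 'a measure \<Rightarrow> ennreal" where
  "perm_test_error n1 n2 B \<alpha> \<nu> P Q =
     (let M = data_law n1 n2 P Q \<Otimes>\<^sub>M perms_law (n1 + n2) B
      in emeasure M {(z, ps) \<in> space M. perm_test n1 n2 B \<alpha> \<nu> z ps = 0})"

text \<open>The type argument names the Hilbert space, which the value of the rate does not determine.\<close>

definition minimax_rate ::
  "'a::{real_inner, polish_space} itself \<Rightarrow> nat \<Rightarrow> nat \<Rightarrow> real \<Rightarrow> real \<Rightarrow> ereal" where
  "minimax_rate _ n1 n2 \<alpha> \<beta> =
     (INF \<psi> \<in> (level_tests n1 n2 \<alpha> :: ((nat \<Rightarrow> 'a) \<Rightarrow> nat) set).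
        separation_rate (\<lambda>_. test_error n1 n2 \<psi>) \<beta>)"

end

theory Submission
  imports Defs
begin

text \<open>
  Let \<open>\<Delta>\<close> be the difference of the two empirical characteristic functions, the observations of the
  first sample carrying the weight \<open>1/n1\<close> and those of the second the weight \<open>-1/n2\<close>. The statistic
  is the mean of \<open>\<bar>\<Delta>\<bar>\<^sup>2\<close> under \<open>\<nu>\<close>, and its population value is the mean \<open>E\<close> of
  \<open>\<bar>\<phi>\<^sub>P - \<phi>\<^sub>Q\<bar>\<^sup>2\<close>, the quantity that defines the alternatives.

  \<^bold>\<open>Upper bound.\<close> With \<open>b = \<phi>\<^sub>P - \<phi>\<^sub>Q\<close>, the inequality \<open>\<bar>\<Delta>\<bar>\<^sup>2 \<ge> 2 Re (\<Delta> b\<^sup>*) - \<bar>b\<bar>\<^sup>2\<close> bounds the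
  statistic from below by an expression that is linear in the empirical measures, hence a sum of
  independent bounded variables. Hoeffding's inequality then puts the statistic above \<open>E/2\<close> with
  high probability (\<open>Ed2_lower_tail\<close>). For fixed data the permuted statistic has mean of order
  \<open>1/n\<close> (the two sample sizes being comparable), since the weights sum to zero and pairs of
  distinct positions are exchangeable (\<open>mean_permuted_Ed2_le\<close>), and one transposition moves it by at most order \<open>1/n\<close>
  (\<open>Ed2_swap_diff_le\<close>). A function of a random permutation with this property is sub-Gaussian
  (\<open>permutation_tail\<close>), with standard deviation of order \<open>n powr (-1/2)\<close>, so only a
  fraction \<open>\<alpha>/2\<close> of all permutations reaches \<open>E/2\<close>. A third use of Hoeffding's inequality, for
  the \<open>B\<close> sampled permutations, shows that fewer than \<open>\<alpha> B\<close> of them do so, except with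
  probability \<open>\<beta>/6\<close>; this is where the lower bound on \<open>B\<close> enters (\<open>perms_law_few_hits\<close>).

  \<^bold>\<open>Lower bound.\<close> The rate of a test is taken uniformly over \<open>\<nu>\<close>, and the test does not see \<open>\<nu>\<close>.
  Take \<open>m\<close> pairs of vectors, all orthonormal, let a coin decide for each pair which member
  belongs to \<open>P\<close> and which to \<open>Q\<close>, and let \<open>P\<close> and \<open>Q\<close> be uniform on their members. In the
  direction \<open>w\<close>, which is \<open>\<pi>\<close> times the sum of the members of \<open>Q\<close>, the characteristic functions are
  \<open>1\<close> and \<open>-1\<close>; a weighting measure with half of its mass on \<open>{w, -w}\<close> therefore sees a
  separation of at least \<open>2\<close> (\<open>orthonormal_halves_in_alternatives\<close>). As long as no pair is drawn
  twice, though, a sample from the random mixture of these alternatives looks like a sample from the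
  uniform law on all \<open>2 m\<close> vectors, which is a null hypothesis. By the birthday bound the two
  differ in total variation by at most \<open>n\<^sup>2/m\<close> (\<open>data_law_null_le_mixture\<close>), and \<open>m\<close> is
  arbitrary because the space has infinite dimension. If \<open>\<rho> < 1\<close>, no level-\<open>\<alpha>\<close> test
  can thus have error at most \<open>\<beta>\<close> over all alternatives of separation at least \<open>\<rho>\<close>: the minimax
  rate is even bounded below by a constant.
\<close>

section \<open>Concentration of functions of a random permutation\<close>

text \<open>Hoeffding's lemma for the uniform distribution on a finite set, with the interval given by the
  oscillation of \<open>f\<close>.\<close>

lemma exp_average_le:
  fixes f :: "'b \<Rightarrow> real"
  assumes "finite I" "I \<noteq> {}" and d: "\<And>x y. x \<in> I \<Longrightarrow> y \<in> I \<Longrightarrow> f x - f y \<le> d" and l: "l > 0"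
  shows "(\<Sum>x\<in>I. exp (l * f x)) / card I \<le> exp (l * ((\<Sum>x\<in>I. f x) / card I) + l\<^sup>2 * d\<^sup>2 / 8)"
proof -
  define \<mu> where "\<mu> = (\<Sum>x\<in>I. f x) / card I"
  define a where "a = Min (f ` I)"
  have fin: "finite (f ` I)" "f ` I \<noteq> {}" using assms by auto
  obtain y where y: "y \<in> I" "a = f y" using Min_in[OF fin] by (auto simp: a_def)
  have a: "f x \<in> {a..a + d}" if "x \<in> I" for x
    using Min_le[OF fin(1), of "f x"] d[OF that y(1)] that y by (auto simp: a_def)
  interpret interval_bounded_random_variable "measure_pmf (pmf_of_set I)" f a "a + d"
    by unfold_locales (use a in \<open>auto simp: AE_measure_pmf_iff set_pmf_of_set[OF assms(2,1)]\<close>)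
  have E: "measure_pmf.expectation (pmf_of_set I) g = (\<Sum>x\<in>I. g x) / card I" for g :: "'b \<Rightarrow> real"
    using assms by (simp add: integral_pmf_of_set)
  have "ennreal ((\<Sum>x\<in>I. exp (l * (f x - \<mu>))) / card I)
      = nn_integral (measure_pmf (pmf_of_set I)) (\<lambda>x. exp (l * (f x - \<mu>)))"
    using assms by (subst E[symmetric], subst nn_integral_eq_integral)
       (use assms(1,2) in \<open>auto intro!: integrable_measure_pmf_finite sum_nonneg divide_nonneg_nonneg
         simp: set_pmf_of_set[OF assms(2,1)]\<close>)
  also have "\<dots> \<le> ennreal (exp (l\<^sup>2 * d\<^sup>2 / 8))"
    using Hoeffdings_lemma_nn_integral[OF l] by (simp add: E \<mu>_def)
  finally have 1: "(\<Sum>x\<in>I. exp (l * (f x - \<mu>))) / card I \<le> exp (l\<^sup>2 * d\<^sup>2 / 8)"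
    by simp
  have "(\<Sum>x\<in>I. exp (l * f x)) / card I = exp (l * \<mu>) * ((\<Sum>x\<in>I. exp (l * (f x - \<mu>))) / card I)"
    by (simp add: sum_distrib_left algebra_simps exp_diff)
  also have "\<dots> \<le> exp (l * \<mu>) * exp (l\<^sup>2 * d\<^sup>2 / 8)"
    by (intro mult_left_mono 1) auto
  finally show ?thesis by (simp add: exp_add \<mu>_def)
qed

abbreviation swap :: "'b \<Rightarrow> 'b \<Rightarrow> 'b \<Rightarrow> 'b" where
  "swap \<equiv> Transposition.transpose"

text \<open>Conjugating a transposition by a transposition gives a transposition. This is why the
  bounded-difference hypothesis of the next lemma survives its induction step.\<close>

lemma swap_comp_swap:
  "swap a b \<circ> swap x y = swap (swap a b x) (swap a b y) \<circ> swap a b"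
  using transpose_comp_eq by (auto simp: fun_eq_iff Transposition.transpose_def)

text \<open>A permutation of \<open>insert a S\<close> is, uniquely, a transposition of \<open>a\<close> with some \<open>b\<close> after a permutation
  of \<open>S\<close>. The induction conditions on \<open>b\<close>: the induction hypothesis handles the permutation of \<open>S\<close>,
  and Hoeffding's lemma handles \<open>b\<close>, because any two conditional means differ by at most \<open>2 d\<close> (undo
  one transposition and perform another). The set \<open>A\<close> stays fixed so that the hypothesis on \<open>f\<close>
  does not change along the induction.\<close>

lemma exp_average_permutations_le:
  fixes f :: "('b \<Rightarrow> 'b) \<Rightarrow> real" and d :: real
  assumes "finite S" "S \<subseteq> A" and l: "l > 0"
    and lip: "\<And>p x y. p permutes A \<Longrightarrow> x \<in> A \<Longrightarrow> y \<in> A \<Longrightarrow> \<bar>f (swap x y \<circ> p) - f p\<bar> \<le> d"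
  shows "(\<Sum>p | p permutes S. exp (l * f p)) / fact (card S)
     \<le> exp (l * ((\<Sum>p | p permutes S. f p) / fact (card S)) + card S * (l\<^sup>2 * d\<^sup>2 / 2))"
  using assms(1,2,4)
proof (induction S arbitrary: f rule: finite_induct)
  case empty
  then show ?case by simp
next
  case (insert a S)
  define I where "I = insert a S"
  define N :: real where "N = fact (card S)"
  have N: "N > 0" by (simp add: N_def)
  have I: "finite I" "I \<noteq> {}" "I \<subseteq> A" "card I = Suc (card S)"
    using insert by (auto simp: I_def)
  define m where "m b = (\<Sum>q | q permutes S. f (swap a b \<circ> q)) / N" for b
  have sub: "q permutes A" if "q permutes S" for q
    using that insert.prems(1) permutes_subset by blast
  \<comment> \<open>The induction hypothesis, for the permutations that have \<open>b\<close> as the image of \<open>a\<close>.\<close>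
  have step: "(\<Sum>q | q permutes S. exp (l * f (swap a b \<circ> q))) / N
     \<le> exp (l * m b + card S * (l\<^sup>2 * d\<^sup>2 / 2))" if "b \<in> I" for b
    unfolding m_def N_def
  proof (rule insert.IH)
    fix p x y assume p: "p permutes A" "x \<in> A" "y \<in> A"
    have ab: "swap a b permutes A"
      using that I insert.prems(1) by (intro permutes_swap_id) auto
    have "swap a b \<circ> (swap x y \<circ> p) =
        swap (swap a b x) (swap a b y) \<circ> (swap a b \<circ> p)"
      using swap_comp_swap[of a b x y] by (simp add: comp_assoc[symmetric])
    then show "\<bar>f (swap a b \<circ> (swap x y \<circ> p)) - f (swap a b \<circ> p)\<bar> \<le> d"
      using insert.prems(2)[of "swap a b \<circ> p" "swap a b x" "swap a b y"]
        permutes_compose[OF p(1) ab] permutes_in_image[OF ab] p by (simp add: comp_assoc del: comp_apply)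
  qed (use insert.prems in auto)
  have m_diff: "m b - m b' \<le> 2 * d" if "b \<in> I" "b' \<in> I" for b b'
  proof -
    have "f (swap a b \<circ> q) - f (swap a b' \<circ> q) \<le> 2 * d" if q: "q permutes S" for q
    proof -
      have "\<bar>f (swap a b \<circ> q) - f q\<bar> \<le> d" "\<bar>f (swap a b' \<circ> q) - f q\<bar> \<le> d"
        using insert.prems(1) \<open>b \<in> I\<close> \<open>b' \<in> I\<close> I
        by (intro insert.prems(2) sub[OF q]; auto)+
      then show ?thesis by linarith
    qed
    then have "(\<Sum>q | q permutes S. f (swap a b \<circ> q) - f (swap a b' \<circ> q))
        \<le> (\<Sum>q | q permutes S. 2 * d)"
      by (intro sum_mono) auto
    also have "\<dots> = N * (2 * d)"
      using card_permutations[OF refl insert.hyps(1)] by (simp add: N_def)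
    finally show ?thesis
      using N by (simp add: m_def sum_subtractf diff_divide_distrib[symmetric] pos_divide_le_eq mult.commute)
  qed
  have "(\<Sum>p | p permutes I. exp (l * f p)) / fact (card I)
      = (\<Sum>b\<in>I. (\<Sum>q | q permutes S. exp (l * f (swap a b \<circ> q))) / N) / card I"
    using insert.hyps I unfolding I_def
    by (subst sum_over_permutations_insert) (auto simp: N_def sum_divide_distrib[symmetric] field_simps)
  also have "\<dots> \<le> (\<Sum>b\<in>I. exp (l * m b + card S * (l\<^sup>2 * d\<^sup>2 / 2))) / card I"
    by (intro divide_right_mono sum_mono step) auto
  also have "\<dots> = exp (card S * (l\<^sup>2 * d\<^sup>2 / 2)) * ((\<Sum>b\<in>I. exp (l * m b)) / card I)"
    by (simp add: exp_add sum_distrib_right mult.commute)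
  also have "\<dots> \<le> exp (card S * (l\<^sup>2 * d\<^sup>2 / 2)) *
      exp (l * ((\<Sum>b\<in>I. m b) / card I) + l\<^sup>2 * (2 * d)\<^sup>2 / 8)"
    by (intro mult_left_mono exp_average_le m_diff I l) auto
  also have "\<dots> = exp (l * ((\<Sum>b\<in>I. m b) / card I) + card I * (l\<^sup>2 * d\<^sup>2 / 2))"
    unfolding exp_add[symmetric] I(4) by (simp add: algebra_simps power2_eq_square add_divide_distrib)
  also have "(\<Sum>b\<in>I. m b) / card I = (\<Sum>p | p permutes I. f p) / fact (card I)"
    using insert.hyps I unfolding I_def
    by (subst sum_over_permutations_insert)
       (auto simp: N_def m_def sum_divide_distrib[symmetric] field_simps)
  finally show ?case by (simp only: I_def)
qed

text \<open>The Chernoff bound for the preceding moment estimate, with the optimal parameter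
  \<open>l = s / (card A * d\<^sup>2)\<close>.\<close>

lemma permutation_tail:
  fixes f :: "('b \<Rightarrow> 'b) \<Rightarrow> real" and d m s :: real
  assumes "finite A" "A \<noteq> {}" and d: "d > 0"
    and lip: "\<And>p x y. p permutes A \<Longrightarrow> x \<in> A \<Longrightarrow> y \<in> A \<Longrightarrow> \<bar>f (swap x y \<circ> p) - f p\<bar> \<le> d"
    and mean: "(\<Sum>p | p permutes A. f p) / fact (card A) \<le> m" and s: "s > 0"
  shows "card {p. p permutes A \<and> f p \<ge> m + s} / fact (card A) \<le> exp (- s\<^sup>2 / (2 * card A * d\<^sup>2))"
proof -
  define n where "n = real (card A)"
  have n: "n > 0" using assms by (auto simp: n_def card_gt_0_iff)
  define l where "l = s / (n * d\<^sup>2)"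
  have l: "l > 0" using s n d by (simp add: l_def)
  let ?B = "{p. p permutes A \<and> f p \<ge> m + s}"
  have finA: "finite {p. p permutes A}" using finite_permutations[OF \<open>finite A\<close>] .
  have "card ?B * exp (l * (m + s)) = (\<Sum>p\<in>?B. exp (l * (m + s)))" by simp
  also have "\<dots> \<le> (\<Sum>p\<in>?B. exp (l * f p))"
    using l by (intro sum_mono) auto
  also have "\<dots> \<le> (\<Sum>p | p permutes A. exp (l * f p))"
    using finA by (intro sum_mono2) auto
  finally have "card ?B / fact (card A) * exp (l * (m + s)) \<le> (\<Sum>p | p permutes A. exp (l * f p)) / fact (card A)"
    by (simp add: divide_right_mono)
  also have "\<dots> \<le> exp (l * ((\<Sum>p | p permutes A. f p) / fact (card A)) + card A * (l\<^sup>2 * d\<^sup>2 / 2))"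
    by (rule exp_average_permutations_le[OF \<open>finite A\<close> subset_refl l lip])
  also have "\<dots> \<le> exp (l * m + n * (l\<^sup>2 * d\<^sup>2 / 2))"
    using mult_left_mono[OF mean, of l] l by (simp add: n_def)
  finally have "card ?B / fact (card A) \<le> exp (l * m + n * (l\<^sup>2 * d\<^sup>2 / 2)) / exp (l * (m + s))"
    by (subst pos_le_divide_eq) auto
  also have "\<dots> = exp (n * (l\<^sup>2 * d\<^sup>2 / 2) - l * s)"
    unfolding exp_diff[symmetric] by (simp add: algebra_simps)
  also have "n * (l\<^sup>2 * d\<^sup>2 / 2) - l * s = - s\<^sup>2 / (2 * n * d\<^sup>2)"
    using n d by (simp add: l_def power2_eq_square field_simps)
  finally show ?thesis by (simp add: n_def)
qed

text \<open>Two distinct positions of a random permutation are exchangeable with any other two: compose with a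
  permutation that carries the first pair to the second.\<close>

lemma sum_permutations_pair:
  fixes h :: "'b \<Rightarrow> 'b \<Rightarrow> real"
  assumes "j \<in> A" "k \<in> A" "j \<noteq> k" "j' \<in> A" "k' \<in> A" "j' \<noteq> k'"
  shows "(\<Sum>p | p permutes A. h (p j) (p k)) = (\<Sum>p | p permutes A. h (p j') (p k'))"
proof -
  \<comment> \<open>First move \<open>j\<close> to \<open>j'\<close>; then move the new place of \<open>k\<close> to \<open>k'\<close>, which leaves \<open>j'\<close> alone.\<close>
  define \<sigma> where "\<sigma> = swap (swap j j' k) k' \<circ> swap j j'"
  have neq: "swap j j' k \<noteq> j'"
    using assms by (auto simp: transpose_eq_iff)
  have \<sigma>: "\<sigma> permutes A" unfolding \<sigma>_def
    using assms by (intro permutes_compose permutes_swap_id) (auto simp: Transposition.transpose_def)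
  have "\<sigma> j = j'" "\<sigma> k = k'"
    using neq assms by (auto simp: \<sigma>_def)
  then have "(\<Sum>p | p permutes A. h (p j') (p k')) = (\<Sum>p | p permutes A. h ((p \<circ> \<sigma>) j) ((p \<circ> \<sigma>) k))"
    by simp
  also have "\<dots> = (\<Sum>p | p permutes A. h (p j) (p k))"
    by (rule sum_permutations_compose_right[OF \<sigma>, symmetric])
  finally show ?thesis by simp
qed

section \<open>Hoeffding's inequality for product measures\<close>

text \<open>The coordinates of a product measure are independent, so Hoeffding's inequality applies to a sum
  of bounded functions of the single coordinates.\<close>

lemma PiM_Hoeffding_le:
  fixes f :: "'i \<Rightarrow> 'b \<Rightarrow> real"
  assumes "finite I" and M: "\<And>i. i \<in> I \<Longrightarrow> prob_space (M i)"
    and f: "\<And>i. i \<in> I \<Longrightarrow> f i \<in> borel_measurable (M i)"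
    and bound: "\<And>i x. i \<in> I \<Longrightarrow> x \<in> space (M i) \<Longrightarrow> f i x \<in> {a i..b i}"
    and eps: "\<epsilon> \<ge> 0" and pos: "(\<Sum>i\<in>I. (b i - a i)\<^sup>2) > 0"
  shows "measure (PiM I M) {x \<in> space (PiM I M). (\<Sum>i\<in>I. f i (x i)) \<le> (\<Sum>i\<in>I. \<integral>y. f i y \<partial>M i) - \<epsilon>}
    \<le> exp (-2 * \<epsilon>\<^sup>2 / (\<Sum>i\<in>I. (b i - a i)\<^sup>2))"
proof -
  interpret prob_space "PiM I M" by (intro prob_space_PiM M)
  have "I \<noteq> {}" using pos by auto
  have "distr (PiM I M) (PiM I M) (\<lambda>x. \<lambda>i\<in>I. x i) = distr (PiM I M) (PiM I M) (\<lambda>x. x)"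
    by (intro distr_cong refl) (auto simp: space_PiM PiE_def extensional_restrict)
  also have "\<dots> = PiM I (\<lambda>i. distr (PiM I M) (M i) (\<lambda>x. x i))"
    by (subst distr_id2) (auto intro!: PiM_cong distr_PiM_component[OF M, symmetric])
  finally have ind: "indep_vars M (\<lambda>i x. x i) I"
    by (subst indep_vars_iff_distr_eq_PiM'[OF \<open>I \<noteq> {}\<close>]) auto
  interpret Hoeffding_ineq "PiM I M" I "\<lambda>i x. f i (x i)" a b "\<Sum>i\<in>I. expectation (\<lambda>x. f i (x i))"
  proof unfold_locales
    show "indep_vars (\<lambda>_. borel) (\<lambda>i x. f i (x i)) I"
      using f by (intro indep_vars_compose2[OF ind]) auto
    show "AE x in PiM I M. f i (x i) \<in> {a i..b i}" if "i \<in> I" for i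
      using bound[OF that] that by (intro AE_I2) (auto simp: space_PiM PiE_def Pi_def)
  qed (use \<open>finite I\<close> in auto)
  have "expectation (\<lambda>x. f i (x i)) = (\<integral>y. f i y \<partial>M i)" if "i \<in> I" for i
  proof -
    have "(\<integral>y. f i y \<partial>M i) = (\<integral>y. f i y \<partial>distr (PiM I M) (M i) (\<lambda>x. x i))"
      by (subst distr_PiM_component[of I M i, OF M that]) auto
    also have "\<dots> = expectation (\<lambda>x. f i (x i))"
      using that f by (intro integral_distr) auto
    finally show ?thesis by simp
  qed
  then have "(\<Sum>i\<in>I. expectation (\<lambda>x. f i (x i))) = (\<Sum>i\<in>I. \<integral>y. f i y \<partial>M i)"
    by (intro sum.cong refl)
  then show ?thesis using Hoeffding_ineq_le[OF eps pos] by simp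
qed

text \<open>The sampled permutations fall into \<open>G\<close> at least a fraction \<open>1 - \<alpha>/2\<close> of the time on average, so a
  fraction of at most \<open>1 - \<alpha>\<close> is a deviation of \<open>\<alpha> B / 2\<close> for a sum of \<open>B\<close> indicators.\<close>

lemma perms_law_few_hits:
  assumes "B \<ge> 1" "\<alpha> \<ge> 0" and G: "G \<subseteq> {p. p permutes {1..n}}"
    and large: "card G / fact n \<ge> 1 - \<alpha> / 2"
  shows "measure (perms_law n B) {ps \<in> space (perms_law n B).
     (\<Sum>b\<in>{1..B}. indicator G (ps b)) \<le> (1 - \<alpha>) * B} \<le> exp (- \<alpha>\<^sup>2 * B / 2)"
proof -
  let ?S = "{p. p permutes {1..n}}"
  let ?U = "uniform_count_measure ?S"
  have finS: "finite ?S" by (simp add: finite_permutations)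
  have neS: "?S \<noteq> {}" using permutes_id by blast
  interpret U: prob_space ?U by (rule prob_space_uniform_count_measure[OF finS neS])
  have "(\<integral>p. indicator G p \<partial>?U) = measure ?U G"
    using G by (simp add: space_uniform_count_measure Int_absorb2)
  also have "\<dots> = card G / fact n"
    using measure_uniform_count_measure[OF finS G] card_permutations[of "{1..n}" n] by simp
  finally have int: "(\<integral>p. indicator G p \<partial>?U) = card G / (fact n :: real)" .
  have "measure (perms_law n B) {ps \<in> space (perms_law n B).
     (\<Sum>b\<in>{1..B}. indicator G (ps b)) \<le> (\<Sum>b\<in>{1..B}. \<integral>p. indicator G p \<partial>?U) - \<alpha> / 2 * B}
     \<le> exp (-2 * (\<alpha> / 2 * B)\<^sup>2 / (\<Sum>b\<in>{1..B}. (1 - 0)\<^sup>2))"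
    unfolding perms_law_def
  proof (rule PiM_Hoeffding_le)
    show "indicator G \<in> borel_measurable ?U"
      using G by (intro borel_measurable_indicator) (simp add: sets_uniform_count_measure)
    show "prob_space ?U" by (rule U.prob_space_axioms)
  qed (use assms in \<open>auto simp: indicator_def\<close>)
  also have "-2 * (\<alpha> / 2 * B)\<^sup>2 / (\<Sum>b\<in>{1..B}. (1 - 0)\<^sup>2) = - \<alpha>\<^sup>2 * B / 2"
    using \<open>B \<ge> 1\<close> by (simp add: power2_eq_square field_simps)
  also have "(\<Sum>b\<in>{1..B}. \<integral>p. indicator G p \<partial>?U) = B * (card G / fact n)"
    by (subst int) simp
  finally have *: "measure (perms_law n B) {ps \<in> space (perms_law n B).
     (\<Sum>b\<in>{1..B}. indicator G (ps b)) \<le> B * (card G / fact n) - \<alpha> / 2 * B} \<le> exp (- \<alpha>\<^sup>2 * B / 2)" .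
  have "(1 - \<alpha>) * B = B * (1 - \<alpha> / 2) - \<alpha> / 2 * B" by (simp add: algebra_simps)
  also have "\<dots> \<le> B * (card G / fact n) - \<alpha> / 2 * B"
    using large by (intro diff_right_mono mult_left_mono) auto
  finally have le: "(1 - \<alpha>) * B \<le> B * (card G / fact n) - \<alpha> / 2 * B" .
  interpret PL: prob_space "perms_law n B"
    unfolding perms_law_def by (intro prob_space_PiM U.prob_space_axioms)
  have [measurable]: "indicator G \<in> borel_measurable ?U"
    using G by (intro borel_measurable_indicator) (simp add: sets_uniform_count_measure)
  have "{ps \<in> space (perms_law n B). (\<Sum>b\<in>{1..B}. indicator G (ps b)) \<le> B * (card G / fact n) - \<alpha> / 2 * B}
    \<in> sets (perms_law n B)"
    unfolding perms_law_def by measurable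
  then show ?thesis
    using le by (intro order_trans[OF PL.finite_measure_mono *]) auto
qed

section \<open>Characteristic functions\<close>

lemma borel_probD:
  assumes "P \<in> borel_prob"
  shows "prob_space P" "sets P = sets borel" "space P = UNIV"
  using assms sets_eq_imp_space_eq[of P borel] by (auto simp: borel_prob_def)

lemma char_fun_conv_cis: "char_fun P w = (LINT z|P. cis (w \<bullet> z))"
  unfolding char_fun_def by (simp add: cis_conv_exp)

lemma borel_measurable_cis [measurable]: "cis \<in> borel_measurable borel"
  by (intro borel_measurable_continuous_onI continuous_intros)

lemma integrable_cis_inner:
  fixes P :: "'a::{real_inner, polish_space} measure"
  assumes "P \<in> borel_prob"
  shows "integrable P (\<lambda>z. cis (w \<bullet> z))"
proof -
  interpret prob_space P using borel_probD[OF assms] by simp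
  have [measurable_cong]: "sets P = sets borel" using borel_probD[OF assms] by simp
  show ?thesis by (rule integrable_const_bound[where B = 1]) auto
qed

lemma cmod_char_fun_le_1:
  fixes P :: "'a::{real_inner, polish_space} measure"
  assumes "P \<in> borel_prob"
  shows "cmod (char_fun P w) \<le> 1"
proof -
  interpret prob_space P using borel_probD[OF assms] by simp
  have "cmod (char_fun P w) \<le> (LINT z|P. cmod (cis (w \<bullet> z)))"
    unfolding char_fun_conv_cis by (rule integral_norm_bound)
  then show ?thesis by (simp add: prob_space)
qed

lemma char_fun_0:
  fixes P :: "'a::{real_inner, polish_space} measure"
  assumes "P \<in> borel_prob"
  shows "char_fun P 0 = 1"
proof -
  interpret prob_space P using borel_probD[OF assms] by simp
  show ?thesis by (simp add: char_fun_conv_cis prob_space)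
qed

lemma borel_measurable_cnj [measurable]: "cnj \<in> borel_measurable borel"
  by (intro borel_measurable_continuous_onI continuous_intros)

lemma borel_measurable_char_fun:
  fixes P :: "'a::{real_inner, polish_space} measure"
  assumes "P \<in> borel_prob"
  shows "char_fun P \<in> borel_measurable borel"
proof -
  interpret prob_space P using borel_probD[OF assms] by simp
  have [measurable_cong]: "sets P = sets borel" using borel_probD[OF assms] by simp
  have "(\<lambda>w. LINT z|P. cis (w \<bullet> z)) \<in> borel_measurable borel"
    by measurable
  then show ?thesis by (simp add: char_fun_conv_cis[abs_def])
qed

section \<open>The statistic as a squared distance\<close>

definition signed_weight :: "nat \<Rightarrow> nat \<Rightarrow> nat \<Rightarrow> real" where
  "signed_weight n1 n2 j = (if j \<le> n1 then 1 / real n1 else - 1 / real n2)"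

text \<open>The difference of the two empirical characteristic functions, called \<open>\<Delta>\<close> above.\<close>

definition emp_diff :: "nat \<Rightarrow> nat \<Rightarrow> (nat \<Rightarrow> 'a::real_inner) \<Rightarrow> 'a \<Rightarrow> complex" where
  "emp_diff n1 n2 z w = (\<Sum>j\<in>{1..n1 + n2}. signed_weight n1 n2 j * cis (w \<bullet> z j))"

lemma sum_two_samples:
  "(\<Sum>j\<in>{1..n1 + n2}. f (j::nat)) = (\<Sum>j\<in>{1..n1}. f j) + (\<Sum>j\<in>{n1 + 1..n1 + n2}. f j)"
  by (rule sum.ub_add_nat) simp

lemma sum_signed_weight: "n1 \<ge> 1 \<Longrightarrow> n2 \<ge> 1 \<Longrightarrow> (\<Sum>j\<in>{1..n1 + n2}. signed_weight n1 n2 j) = 0"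
  unfolding sum_two_samples by (simp add: signed_weight_def)

lemma sum_abs_signed_weight:
  "n1 \<ge> 1 \<Longrightarrow> n2 \<ge> 1 \<Longrightarrow> (\<Sum>j\<in>{1..n1 + n2}. \<bar>signed_weight n1 n2 j\<bar>) = 2"
  unfolding sum_two_samples by (simp add: signed_weight_def)

lemma sum_signed_weight_squared:
  "n1 \<ge> 1 \<Longrightarrow> n2 \<ge> 1 \<Longrightarrow> (\<Sum>j\<in>{1..n1 + n2}. (signed_weight n1 n2 j)\<^sup>2) = 1 / n1 + 1 / n2"
  unfolding sum_two_samples by (simp add: signed_weight_def power2_eq_square)

text \<open>The scaled weight matrix has rank one, which makes the statistic a squared norm.\<close>

lemma Q_weight_conv_signed_weight:
  assumes "n1 \<ge> 1" "n2 \<ge> 1" "j \<in> {1..n1 + n2}" "k \<in> {1..n1 + n2}"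
  shows "real (n1 + n2) / (real n1 * real n2) * Q_weight n1 n2 j k
     = signed_weight n1 n2 j * signed_weight n1 n2 k"
proof -
  have pos: "real n1 > 0" "real n2 > 0" using assms by auto
  have "(x + y) / (x * y) * (1 / x - 1 / (x + y)) = 1 / x * (1 / x)"
    "(x + y) / (x * y) * (1 / y - 1 / (x + y)) = 1 / y * (1 / y)"
    "(x + y) / (x * y) * (1 / (x + y)) = 1 / x * (1 / y)" if "x > 0" "y > 0" for x y :: real
    using that by (auto simp: divide_simps)
  note * = this[OF pos]
  show ?thesis
    using assms * by (cases "j \<le> n1"; cases "k \<le> n1") (auto simp: Q_weight_def signed_weight_def)
qed

lemma Ed2_conv_signed_weight:
  assumes "n1 \<ge> 1" "n2 \<ge> 1"
  shows "Ed2 \<nu> n1 n2 z = (\<Sum>j\<in>{1..n1 + n2}. \<Sum>k\<in>{1..n1 + n2}.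
     signed_weight n1 n2 j * signed_weight n1 n2 k * Re (char_fun \<nu> (z j - z k)))"
  unfolding Ed2_def sum_distrib_left
proof (intro sum.cong refl)
  fix j k assume "j \<in> {1..n1 + n2}" "k \<in> {1..n1 + n2}"
  from Q_weight_conv_signed_weight[OF assms this, symmetric]
  show "real (n1 + n2) / (real n1 * real n2) * (Re (char_fun \<nu> (z j - z k)) * Q_weight n1 n2 j k)
     = signed_weight n1 n2 j * signed_weight n1 n2 k * Re (char_fun \<nu> (z j - z k))" by simp
qed

lemma Ed2_perm_conv_Ed2: "Ed2_perm \<nu> n1 n2 z p = Ed2 \<nu> n1 n2 (z \<circ> p)"
  by (simp add: Ed2_perm_def Ed2_def)

lemma cmod_emp_diff_le_2:
  assumes "n1 \<ge> 1" "n2 \<ge> 1"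
  shows "cmod (emp_diff n1 n2 z w) \<le> 2"
proof -
  have "cmod (emp_diff n1 n2 z w) \<le> (\<Sum>j\<in>{1..n1 + n2}. cmod (signed_weight n1 n2 j * cis (w \<bullet> z j)))"
    unfolding emp_diff_def by (rule norm_sum)
  also have "\<dots> = 2"
    using sum_abs_signed_weight[OF assms] by (simp add: norm_mult)
  finally show ?thesis .
qed

lemma borel_measurable_emp_diff [measurable]:
  fixes z :: "nat \<Rightarrow> 'a::{real_inner, polish_space}"
  shows "emp_diff n1 n2 z \<in> borel_measurable borel"
  unfolding emp_diff_def by measurable

lemma cmod_emp_diff_squared:
  "(cmod (emp_diff n1 n2 z w))\<^sup>2 = (\<Sum>j\<in>{1..n1 + n2}. \<Sum>k\<in>{1..n1 + n2}.
     signed_weight n1 n2 j * signed_weight n1 n2 k * Re (cis ((z j - z k) \<bullet> w)))"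
proof -
  have "complex_of_real ((cmod (emp_diff n1 n2 z w))\<^sup>2) = emp_diff n1 n2 z w * cnj (emp_diff n1 n2 z w)"
    by (rule complex_norm_square)
  also have "\<dots> = (\<Sum>j\<in>{1..n1 + n2}. \<Sum>k\<in>{1..n1 + n2}.
     of_real (signed_weight n1 n2 j * signed_weight n1 n2 k) * cis ((z j - z k) \<bullet> w))"
    unfolding emp_diff_def cnj_sum sum_product
    by (intro sum.cong refl) (simp add: cis_cnj inner_diff_left inner_commute[of w] cis_mult field_simps flip: cis_divide)
  finally have "(cmod (emp_diff n1 n2 z w))\<^sup>2 = Re (\<Sum>j\<in>{1..n1 + n2}. \<Sum>k\<in>{1..n1 + n2}.
     of_real (signed_weight n1 n2 j * signed_weight n1 n2 k) * cis ((z j - z k) \<bullet> w))"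
    by (metis Re_complex_of_real)
  then show ?thesis by (simp add: Re_sum)
qed

lemma Ed2_conv_integral:
  fixes \<nu> :: "'a::{real_inner, polish_space} measure"
  assumes "n1 \<ge> 1" "n2 \<ge> 1" "\<nu> \<in> borel_prob"
  shows "Ed2 \<nu> n1 n2 z = (LINT w|\<nu>. (cmod (emp_diff n1 n2 z w))\<^sup>2)"
proof -
  note int = integrable_cis_inner[OF assms(3)]
  define I where "I = {1..n1 + n2}"
  define c where "c j k = signed_weight n1 n2 j * signed_weight n1 n2 k" for j k
  have int_c: "integrable \<nu> (\<lambda>w. c j k * Re (cis ((z j - z k) \<bullet> w)))" for j k
    by (intro integrable_mult_right integrable_Re int)
  have "(LINT w|\<nu>. (cmod (emp_diff n1 n2 z w))\<^sup>2)
      = (LINT w|\<nu>. (\<Sum>j\<in>I. \<Sum>k\<in>I. c j k * Re (cis ((z j - z k) \<bullet> w))))"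
    unfolding cmod_emp_diff_squared c_def I_def ..
  also have "\<dots> = (\<Sum>j\<in>I. LINT w|\<nu>. (\<Sum>k\<in>I. c j k * Re (cis ((z j - z k) \<bullet> w))))"
    by (intro Bochner_Integration.integral_sum Bochner_Integration.integrable_sum int_c)
  also have "\<dots> = (\<Sum>j\<in>I. \<Sum>k\<in>I. LINT w|\<nu>. c j k * Re (cis ((z j - z k) \<bullet> w)))"
    by (intro sum.cong refl Bochner_Integration.integral_sum int_c)
  also have "\<dots> = (\<Sum>j\<in>I. \<Sum>k\<in>I. c j k * (LINT w|\<nu>. Re (cis ((z j - z k) \<bullet> w))))"
    by (simp only: integral_mult_right_zero)
  also have "\<dots> = Ed2 \<nu> n1 n2 z"
    unfolding Ed2_conv_signed_weight[OF assms(1,2)] char_fun_conv_cis c_def I_def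
    by (simp only: integral_Re[OF int])
  finally show ?thesis by simp
qed

lemma integrable_cmod_emp_diff_squared:
  fixes \<nu> :: "'a::{real_inner, polish_space} measure"
  assumes "n1 \<ge> 1" "n2 \<ge> 1" "\<nu> \<in> borel_prob"
  shows "integrable \<nu> (\<lambda>w. (cmod (emp_diff n1 n2 z w))\<^sup>2)"
  unfolding cmod_emp_diff_squared
  by (intro Bochner_Integration.integrable_sum)
    (rule integrable_mult_right, rule integrable_Re, rule integrable_cis_inner[OF assms(3)])

text \<open>Transposing two values of \<open>p\<close> changes at most two summands, each by at most twice its weight.\<close>

lemma cmod_emp_diff_swap_le:
  assumes "n1 \<ge> 1" "n2 \<ge> 1" "p permutes {1..n1 + n2}"
  shows "cmod (emp_diff n1 n2 (z \<circ> (swap x y \<circ> p)) w - emp_diff n1 n2 (z \<circ> p) w)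
    \<le> 4 / real (min n1 n2)"
proof -
  define J where "J = {j \<in> {1..n1 + n2}. p j = x \<or> p j = y}"
  define A where "A = 1 / real (min n1 n2)"
  have a: "\<bar>signed_weight n1 n2 j\<bar> \<le> A" for j
    using assms by (auto simp: signed_weight_def A_def field_simps)
  have "J \<subseteq> {inv p x, inv p y}"
    using permutes_inverses[OF assms(3)] by (auto simp: J_def)
  then have "card J \<le> 2"
    using card_mono[of "{inv p x, inv p y}" J] by (simp add: card_insert_if split: if_splits)
  have "emp_diff n1 n2 (z \<circ> (swap x y \<circ> p)) w - emp_diff n1 n2 (z \<circ> p) w
     = (\<Sum>j\<in>{1..n1 + n2}. signed_weight n1 n2 j * (cis (w \<bullet> z (swap x y (p j))) - cis (w \<bullet> z (p j))))"
    unfolding emp_diff_def by (simp add: sum_subtractf[symmetric] algebra_simps)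
  also have "\<dots> = (\<Sum>j\<in>J. signed_weight n1 n2 j * (cis (w \<bullet> z (swap x y (p j))) - cis (w \<bullet> z (p j))))"
    by (rule sum.mono_neutral_right) (auto simp: J_def)
  also have "cmod \<dots> \<le> (\<Sum>j\<in>J. A * 2)"
  proof (rule sum_norm_le)
    fix j
    have "cmod (cis (w \<bullet> z (swap x y (p j))) - cis (w \<bullet> z (p j))) \<le> 2"
      using norm_triangle_ineq4[of "cis (w \<bullet> z (swap x y (p j)))" "cis (w \<bullet> z (p j))"] by simp
    then show "cmod (signed_weight n1 n2 j * (cis (w \<bullet> z (swap x y (p j))) - cis (w \<bullet> z (p j)))) \<le> A * 2"
      unfolding norm_mult using a[of j] by (intro mult_mono) auto
  qed
  also have "\<dots> \<le> 2 * (A * 2)"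
    using \<open>card J \<le> 2\<close> by (simp add: A_def divide_right_mono)
  finally show ?thesis by (simp add: A_def)
qed

lemma Ed2_swap_diff_le:
  fixes \<nu> :: "'a::{real_inner, polish_space} measure"
  assumes "n1 \<ge> 1" "n2 \<ge> 1" "\<nu> \<in> borel_prob" "p permutes {1..n1 + n2}"
  shows "\<bar>Ed2 \<nu> n1 n2 (z \<circ> (swap x y \<circ> p)) - Ed2 \<nu> n1 n2 (z \<circ> p)\<bar> \<le> 16 / real (min n1 n2)"
proof -
  interpret prob_space \<nu> using borel_probD[OF assms(3)] by simp
  let ?V = "\<lambda>w. cmod (emp_diff n1 n2 (z \<circ> (swap x y \<circ> p)) w)" and ?U = "\<lambda>w. cmod (emp_diff n1 n2 (z \<circ> p) w)"
  let ?A = "1 / real (min n1 n2)"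
  have *: "\<bar>(?V w)\<^sup>2 - (?U w)\<^sup>2\<bar> \<le> 16 * ?A" for w
  proof -
    have "\<bar>?V w - ?U w\<bar> \<le> 4 * ?A"
      using cmod_emp_diff_swap_le[OF assms(1,2,4), of z x y w] norm_triangle_ineq3 order_trans by fastforce
    moreover have "?V w \<le> 2" "?U w \<le> 2"
      by (rule cmod_emp_diff_le_2[OF assms(1,2)])+
    ultimately have "\<bar>?V w - ?U w\<bar> * \<bar>?V w + ?U w\<bar> \<le> (4 * ?A) * 4"
      by (intro mult_mono) auto
    moreover have "(?V w)\<^sup>2 - (?U w)\<^sup>2 = (?V w - ?U w) * (?V w + ?U w)"
      by (simp add: power2_eq_square algebra_simps)
    ultimately show ?thesis by (simp add: abs_mult)
  qed
  note int = integrable_cmod_emp_diff_squared[OF assms(1-3)]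
  have "\<bar>Ed2 \<nu> n1 n2 (z \<circ> (swap x y \<circ> p)) - Ed2 \<nu> n1 n2 (z \<circ> p)\<bar> = \<bar>LINT w|\<nu>. (?V w)\<^sup>2 - (?U w)\<^sup>2\<bar>"
    unfolding Ed2_conv_integral[OF assms(1-3)] by (subst Bochner_Integration.integral_diff[OF int int]) simp
  also have "\<dots> \<le> (LINT w|\<nu>. \<bar>(?V w)\<^sup>2 - (?U w)\<^sup>2\<bar>)"
    using integral_norm_bound[of \<nu> "\<lambda>w. (?V w)\<^sup>2 - (?U w)\<^sup>2"] by simp
  also have "\<dots> \<le> (LINT w|\<nu>. 16 * ?A)"
    by (rule integral_mono[OF integrable_abs[OF Bochner_Integration.integrable_diff[OF int int]] integrable_const *])
  also have "\<dots> = 16 * ?A" by (simp add: prob_space)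
  finally show ?thesis by simp
qed

text \<open>Averaged over the permutations, the kernel is \<open>1\<close> on the diagonal and one constant \<open>r\<close> off it. As the
  weights sum to zero, the mean of the statistic is \<open>(1 - r)\<close> times the sum of the squared weights.\<close>

lemma mean_permuted_Ed2_le:
  fixes \<nu> :: "'a::{real_inner, polish_space} measure"
  assumes n: "n1 \<ge> 1" "n2 \<ge> 1" and \<nu>: "\<nu> \<in> borel_prob"
  shows "(\<Sum>p | p permutes {1..n1 + n2}. Ed2 \<nu> n1 n2 (z \<circ> p)) / fact (n1 + n2) \<le> 4 / real (min n1 n2)"
proof -
  define I where "I = {1..n1 + n2}"
  define a where "a = signed_weight n1 n2"
  define N :: real where "N = fact (n1 + n2)"
  define K where "K x y = Re (char_fun \<nu> (z x - z y))" for x y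
  define R where "R j k = (\<Sum>p | p permutes I. K (p j) (p k)) / N" for j k
  have card: "real (card {p. p permutes I}) = N"
    using card_permutations[of I "n1 + n2"] by (simp add: I_def N_def)
  have N: "N > 0" by (simp add: N_def)
  have diag: "R j j = 1" for j
    using N card by (simp add: R_def K_def char_fun_0[OF \<nu>])
  have K: "\<bar>K x y\<bar> \<le> 1" for x y
    using abs_Re_le_cmod cmod_char_fun_le_1[OF \<nu>] order_trans unfolding K_def by blast
  define r where "r = R 1 2"
  have off: "R j k = r" if "j \<in> I" "k \<in> I" "j \<noteq> k" for j k
    unfolding r_def R_def using that n
    by (intro arg_cong2[where f = "(/)"] sum_permutations_pair refl) (auto simp: I_def)
  have "\<bar>\<Sum>p | p permutes I. K (p 1) (p 2)\<bar> \<le> (\<Sum>p | p permutes I. 1)"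
    by (rule order_trans[OF sum_abs sum_mono[OF K]])
  then have r: "\<bar>r\<bar> \<le> 1"
    unfolding r_def R_def using card N by (simp add: divide_le_eq)
  have "(\<Sum>p | p permutes I. Ed2 \<nu> n1 n2 (z \<circ> p)) / N = (\<Sum>j\<in>I. \<Sum>k\<in>I. a j * a k * R j k)"
    unfolding Ed2_conv_signed_weight[OF n] R_def a_def[symmetric] I_def[symmetric]
      sum.swap[of _ _ "{p. p permutes I}"]
    by (simp add: sum_divide_distrib sum_distrib_left K_def)
  also have "\<dots> = (\<Sum>j\<in>I. \<Sum>k\<in>I. r * (a j * a k) + (if j = k then (1 - r) * (a j)\<^sup>2 else 0))"
    by (intro sum.cong refl) (auto simp: diag off algebra_simps power2_eq_square)
  also have "\<dots> = r * ((\<Sum>j\<in>I. a j) * (\<Sum>k\<in>I. a k)) + (1 - r) * (\<Sum>j\<in>I. (a j)\<^sup>2)"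
    unfolding sum.distrib sum_product by (simp add: sum_distrib_left I_def)
  also have "\<dots> = (1 - r) * (1 / n1 + 1 / n2)"
    using sum_signed_weight[OF n] sum_signed_weight_squared[OF n] by (simp add: a_def I_def)
  also have "\<dots> \<le> 2 * (1 / real (min n1 n2) + 1 / real (min n1 n2))"
    using r n by (intro mult_mono add_mono) (auto simp: field_simps)
  finally show ?thesis by (simp add: I_def N_def)
qed

section \<open>Lower tail of the statistic\<close>

text \<open>Fubini's theorem: the linear functional of the data that is obtained by integrating
  \<open>cis (w \<bullet> x)\<close> against \<open>b\<close> has an expectation that only involves the characteristic function.\<close>

lemma integral_Re_cis_mult_char_fun:
  fixes P \<nu> :: "'a::{real_inner, polish_space} measure" and b :: "'a \<Rightarrow> complex"
  assumes P: "P \<in> borel_prob" and \<nu>: "\<nu> \<in> borel_prob"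
    and b [measurable]: "b \<in> borel_measurable borel" and bound: "\<And>w. cmod (b w) \<le> 2"
  shows "(\<lambda>x. LINT w|\<nu>. Re (cis (w \<bullet> x) * cnj (b w))) \<in> borel_measurable P"
    and "(LINT x|P. LINT w|\<nu>. Re (cis (w \<bullet> x) * cnj (b w))) = (LINT w|\<nu>. Re (char_fun P w * cnj (b w)))"
proof -
  interpret P: prob_space P using borel_probD[OF P] by simp
  interpret V: prob_space \<nu> using borel_probD[OF \<nu>] by simp
  have [measurable_cong]: "sets P = sets borel" "sets \<nu> = sets borel"
    using borel_probD P \<nu> by auto
  interpret PV: pair_prob_space P \<nu> ..
  show "(\<lambda>x. LINT w|\<nu>. Re (cis (w \<bullet> x) * cnj (b w))) \<in> borel_measurable P"
    by measurable
  have "(LINT x|P. LINT w|\<nu>. Re (cis (w \<bullet> x) * cnj (b w))) = (LINT w|\<nu>. LINT x|P. Re (cis (w \<bullet> x) * cnj (b w)))"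
  proof (rule PV.Fubini_integral[symmetric])
    show "integrable (P \<Otimes>\<^sub>M \<nu>) (\<lambda>(x, w). Re (cis (w \<bullet> x) * cnj (b w)))"
    proof (rule PV.integrable_const_bound[where B = 2])
      have "\<bar>Re (cis (w \<bullet> x) * cnj (b w))\<bar> \<le> 2" for x w
        using abs_Re_le_cmod[of "cis (w \<bullet> x) * cnj (b w)"] bound[of w] by (simp add: norm_mult)
      then show "AE xw in P \<Otimes>\<^sub>M \<nu>. norm (case xw of (x, w) \<Rightarrow> Re (cis (w \<bullet> x) * cnj (b w))) \<le> 2"
        by (auto simp del: cis.sel times_complex.sel)
    qed measurable
  qed
  also have "\<dots> = (LINT w|\<nu>. Re (char_fun P w * cnj (b w)))"
  proof (rule Bochner_Integration.integral_cong[OF refl])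
    fix w
    have int: "integrable P (\<lambda>x. cis (w \<bullet> x) * cnj (b w))"
      by (intro integrable_mult_left integrable_cis_inner[OF P])
    show "(LINT x|P. Re (cis (w \<bullet> x) * cnj (b w))) = Re (char_fun P w * cnj (b w))"
      unfolding integral_Re[OF int] char_fun_conv_cis by simp
  qed
  finally show "(LINT x|P. LINT w|\<nu>. Re (cis (w \<bullet> x) * cnj (b w))) = (LINT w|\<nu>. Re (char_fun P w * cnj (b w)))" .
qed

text \<open>The statistic is quadratic in the data, but \<open>\<bar>u\<bar>\<^sup>2 \<ge> 2 Re (u b\<^sup>*) - \<bar>b\<bar>\<^sup>2\<close> with
  \<open>b = char_fun P - char_fun Q\<close> bounds it below by \<open>2 S - E\<close>, where \<open>S\<close> is a weighted sum of
  independent variables \<open>g (z j)\<close> with values in \<open>[-2, 2]\<close> and total mean \<open>E\<close>. Unless \<open>S\<close> falls short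
  of its mean by \<open>E/4\<close>, the bound exceeds \<open>E/2\<close>. Naming the exceptional set \<open>G\<close> of \<open>S\<close> avoids any
  measurability argument for the statistic itself.\<close>

lemma Ed2_lower_tail:
  fixes P Q \<nu> :: "'a::{real_inner, polish_space} measure"
  assumes n: "n1 \<ge> 1" "n2 \<ge> 1" and P: "P \<in> borel_prob" and Q: "Q \<in> borel_prob" and \<nu>: "\<nu> \<in> borel_prob"
  defines "E \<equiv> (LINT w|\<nu>. (cmod (char_fun P w - char_fun Q w))\<^sup>2)"
  assumes E: "E \<ge> 0"
  shows "\<exists>G \<in> sets (data_law n1 n2 P Q).
     measure (data_law n1 n2 P Q) G \<le> exp (- E\<^sup>2 / (128 * (1 / n1 + 1 / n2))) \<and>
     (\<forall>z \<in> space (data_law n1 n2 P Q) - G. E / 2 < Ed2 \<nu> n1 n2 z)"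
proof -
  interpret P: prob_space P using borel_probD[OF P] by simp
  interpret Q: prob_space Q using borel_probD[OF Q] by simp
  interpret V: prob_space \<nu> using borel_probD[OF \<nu>] by simp
  have [measurable_cong]: "sets \<nu> = sets borel" using borel_probD(2)[OF \<nu>] .
  define I where "I = {1..n1 + n2}"
  define a where "a = signed_weight n1 n2"
  define b where "b w = char_fun P w - char_fun Q w" for w
  note [measurable] = borel_measurable_char_fun[OF P] borel_measurable_char_fun[OF Q]
  have b_meas [measurable]: "b \<in> borel_measurable borel" unfolding b_def[abs_def] by measurable
  have b_le: "cmod (b w) \<le> 2" for w
    using norm_triangle_ineq4[of "char_fun P w" "char_fun Q w"] cmod_char_fun_le_1[OF P, of w]
      cmod_char_fun_le_1[OF Q, of w] by (simp add: b_def)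
  have Re_le: "\<bar>Re (u * cnj (b w))\<bar> \<le> 4" if "cmod u \<le> 2" for u w
  proof -
    have "\<bar>Re (u * cnj (b w))\<bar> \<le> cmod u * cmod (b w)"
      using abs_Re_le_cmod[of "u * cnj (b w)"] by (simp add: norm_mult)
    also have "\<dots> \<le> 2 * 2" using that b_le by (intro mult_mono) auto
    finally show ?thesis by simp
  qed
  \<comment> \<open>The contribution of an observation at \<open>x\<close> to the integral of \<open>Re (\<Delta> b\<^sup>*)\<close>, where \<open>\<Delta>\<close> is \<open>emp_diff\<close>.\<close>
  define g where "g x = (LINT w|\<nu>. Re (cis (w \<bullet> x) * cnj (b w)))" for x
  have int_cis: "integrable \<nu> (\<lambda>w. Re (cis (w \<bullet> x) * cnj (b w)))" for x
    by (rule V.integrable_const_bound[where B = 4]) (use Re_le in \<open>auto simp del: cis.sel times_complex.sel\<close>)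
  have int_u: "integrable \<nu> (\<lambda>w. Re (u w * cnj (b w)))"
    if [measurable]: "u \<in> borel_measurable borel" and "\<And>w. cmod (u w) \<le> 2" for u
    by (rule V.integrable_const_bound[where B = 4])
      (use that Re_le in \<open>auto simp del: cis.sel times_complex.sel\<close>)
  have g_le: "\<bar>g x\<bar> \<le> 2" for x
  proof -
    have "\<bar>Re (cis (w \<bullet> x) * cnj (b w))\<bar> \<le> 2" for w
      using abs_Re_le_cmod[of "cis (w \<bullet> x) * cnj (b w)"] b_le[of w] by (simp add: norm_mult)
    then have "(LINT w|\<nu>. \<bar>Re (cis (w \<bullet> x) * cnj (b w))\<bar>) \<le> (LINT w|\<nu>. 2)"
      by (intro integral_mono integrable_abs int_cis V.integrable_const)
    moreover have "\<bar>g x\<bar> \<le> (LINT w|\<nu>. \<bar>Re (cis (w \<bullet> x) * cnj (b w))\<bar>)"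
      unfolding g_def by (rule integral_abs_bound)
    ultimately show ?thesis by (simp add: V.prob_space)
  qed
  have g_P: "g \<in> borel_measurable P" "(LINT x|P. g x) = (LINT w|\<nu>. Re (char_fun P w * cnj (b w)))"
    unfolding g_def[abs_def] by (rule integral_Re_cis_mult_char_fun[OF P \<nu> b_meas b_le])+
  have g_Q: "g \<in> borel_measurable Q" "(LINT x|Q. g x) = (LINT w|\<nu>. Re (char_fun Q w * cnj (b w)))"
    unfolding g_def[abs_def] by (rule integral_Re_cis_mult_char_fun[OF Q \<nu> b_meas b_le])+
  define L where "L j = (if j \<le> n1 then P else Q)" for j
  have D: "data_law n1 n2 P Q = PiM I L" by (simp add: data_law_def I_def L_def[abs_def])
  have "(LINT x|P. g x) - (LINT x|Q. g x) = (LINT w|\<nu>. Re (char_fun P w * cnj (b w)) - Re (char_fun Q w * cnj (b w)))"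
    unfolding g_P(2) g_Q(2)
    using cmod_char_fun_le_1[OF P] cmod_char_fun_le_1[OF Q]
    by (intro Bochner_Integration.integral_diff[symmetric] int_u) (auto intro: order_trans[OF _ one_le_numeral])
  also have "\<dots> = E"
    unfolding E_def
    by (intro Bochner_Integration.integral_cong refl, simp only: cmod_power2)
       (simp add: b_def power2_eq_square algebra_simps)
  finally have mean_diff: "(LINT x|P. g x) - (LINT x|Q. g x) = E" .
  have mean: "(\<Sum>j\<in>I. \<integral>x. a j * g x \<partial>L j) = E"
    unfolding I_def sum_two_samples using n mean_diff by (simp add: a_def signed_weight_def L_def)
  have widths: "(\<Sum>j\<in>I. (2 * \<bar>a j\<bar> - (- 2 * \<bar>a j\<bar>))\<^sup>2) = 16 * (1 / n1 + 1 / n2)"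
  proof -
    have "(\<Sum>j\<in>I. (2 * \<bar>a j\<bar> - (- 2 * \<bar>a j\<bar>))\<^sup>2) = 16 * (\<Sum>j\<in>I. (a j)\<^sup>2)"
      by (simp add: sum_distrib_left power_mult_distrib)
    then show ?thesis using sum_signed_weight_squared[OF n] by (simp add: a_def I_def)
  qed
  define G where "G = {z \<in> space (PiM I L). (\<Sum>j\<in>I. a j * g (z j)) \<le> E - E / 4}"
  have L_prob: "prob_space (L j)" for j
    by (simp add: L_def P.prob_space_axioms Q.prob_space_axioms)
  have g_L [measurable]: "g \<in> borel_measurable (L j)" for j
    using g_P g_Q by (simp add: L_def)
  have "measure (PiM I L) G \<le> exp (-2 * (E / 4)\<^sup>2 / (\<Sum>j\<in>I. (2 * \<bar>a j\<bar> - (- 2 * \<bar>a j\<bar>))\<^sup>2))"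
    unfolding G_def mean[symmetric]
  proof (rule PiM_Hoeffding_le)
    show "a j * g x \<in> {- 2 * \<bar>a j\<bar>..2 * \<bar>a j\<bar>}" for j x
      using mult_left_mono[OF g_le[of x], of "\<bar>a j\<bar>"] by (auto simp: abs_mult[symmetric] abs_le_iff)
    show "0 < (\<Sum>j\<in>I. (2 * \<bar>a j\<bar> - (- 2 * \<bar>a j\<bar>))\<^sup>2)"
      unfolding widths using n by (intro mult_pos_pos add_pos_pos) auto
  qed (use E mean L_prob in \<open>auto simp: I_def\<close>)
  also have "-2 * (E / 4)\<^sup>2 / (\<Sum>j\<in>I. (2 * \<bar>a j\<bar> - (- 2 * \<bar>a j\<bar>))\<^sup>2) = - E\<^sup>2 / (128 * (1 / n1 + 1 / n2))"
    unfolding widths by (simp add: power2_eq_square)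
  finally have prob: "measure (PiM I L) G \<le> exp (- E\<^sup>2 / (128 * (1 / n1 + 1 / n2)))" .
  have "G \<in> sets (PiM I L)" unfolding G_def by measurable
  moreover have "E / 2 < Ed2 \<nu> n1 n2 z" if "z \<in> space (PiM I L) - G" for z
  proof -
    let ?V = "emp_diff n1 n2 z"
    have gt: "(\<Sum>j\<in>I. a j * g (z j)) > 3 / 4 * E"
      using that by (auto simp: G_def)
    have "(\<Sum>j\<in>I. a j * g (z j)) = (LINT w|\<nu>. (\<Sum>j\<in>I. a j * Re (cis (w \<bullet> z j) * cnj (b w))))"
      unfolding g_def using int_cis
      by (subst Bochner_Integration.integral_sum) (auto simp del: cis.sel times_complex.sel)
    also have "\<dots> = (LINT w|\<nu>. Re (?V w * cnj (b w)))"
      unfolding emp_diff_def a_def I_def sum_distrib_right Re_sum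
      by (intro Bochner_Integration.integral_cong refl sum.cong) (simp add: algebra_simps)
    finally have lin: "(\<Sum>j\<in>I. a j * g (z j)) = (LINT w|\<nu>. Re (?V w * cnj (b w)))" .
    have int_V: "integrable \<nu> (\<lambda>w. Re (?V w * cnj (b w)))"
      by (rule int_u[OF borel_measurable_emp_diff cmod_emp_diff_le_2[OF n]])
    have int_b: "integrable \<nu> (\<lambda>w. (cmod (b w))\<^sup>2)"
      using power_mono[OF b_le, of _ 2] by (intro V.integrable_const_bound[where B = 4]) auto
    have "2 * (LINT w|\<nu>. Re (?V w * cnj (b w))) - E = (LINT w|\<nu>. 2 * Re (?V w * cnj (b w)) - (cmod (b w))\<^sup>2)"
      unfolding E_def b_def[symmetric]
      by (subst Bochner_Integration.integral_diff[OF integrable_mult_right[OF int_V] int_b])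
         (simp only: integral_mult_right_zero)
    also have "\<dots> \<le> (LINT w|\<nu>. (cmod (?V w))\<^sup>2)"
    proof (rule integral_mono)
      fix w
      have "(cmod (?V w - b w))\<^sup>2 \<ge> 0" by simp
      then show "2 * Re (?V w * cnj (b w)) - (cmod (b w))\<^sup>2 \<le> (cmod (?V w))\<^sup>2"
        by (simp only: cmod_power2) (simp add: power2_eq_square algebra_simps)
    qed (intro Bochner_Integration.integrable_diff integrable_mult_right int_V int_b
           integrable_cmod_emp_diff_squared[OF n \<nu>])+
    also have "\<dots> = Ed2 \<nu> n1 n2 z" by (rule Ed2_conv_integral[OF n \<nu>, symmetric])
    finally show ?thesis using gt lin by simp
  qed
  ultimately show ?thesis using prob unfolding D by blast
qed

section \<open>Upper bound on the rate of the permutation test\<close>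

text \<open>Outside the exceptional set of the data, the statistic exceeds \<open>E/2\<close>, whereas at most a fraction
  \<open>\<alpha>/2\<close> of the permutations reaches \<open>E/2\<close>; a failure to reject then needs unusually many of those
  among the \<open>B\<close> sampled ones. The two exponentials are the probabilities of these two events.\<close>

lemma perm_test_error_le:
  fixes P Q \<nu> :: "'a::{real_inner, polish_space} measure"
  assumes n: "n1 \<ge> 1" "n2 \<ge> 1" and P: "P \<in> borel_prob" and Q: "Q \<in> borel_prob" and \<nu>: "\<nu> \<in> borel_prob"
    and "B \<ge> 1" "\<alpha> \<ge> 0"
  defines "E \<equiv> (LINT w|\<nu>. (cmod (char_fun P w - char_fun Q w))\<^sup>2)"
    and "m \<equiv> real (min n1 n2)"
  assumes E: "E / 2 > 4 / m"
    and \<alpha>: "exp (- (E / 2 - 4 / m)\<^sup>2 / (2 * real (n1 + n2) * (16 / m)\<^sup>2)) \<le> \<alpha> / 2"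
  shows "perm_test_error n1 n2 B \<alpha> \<nu> P Q
    \<le> ennreal (exp (- E\<^sup>2 / (128 * (1 / n1 + 1 / n2))) + exp (- \<alpha>\<^sup>2 * B / 2))"
proof -
  define D where "D = data_law n1 n2 P Q"
  define n where "n = n1 + n2"
  define S where "S = {p. p permutes {1..n}}"
  interpret D: prob_space D unfolding D_def data_law_def
    using borel_probD(1)[OF P] borel_probD(1)[OF Q] by (intro prob_space_PiM) auto
  have S: "finite S" "card S = fact n"
    using card_permutations[of "{1..n}" n] by (auto simp: S_def finite_permutations)
  then have "S \<noteq> {}" by auto
  interpret R: prob_space "perms_law n B"
    unfolding perms_law_def S_def[symmetric]
    by (intro prob_space_PiM prob_space_uniform_count_measure S \<open>S \<noteq> {}\<close>)
  have m: "m > 0" using n by (simp add: m_def)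
  have "E \<ge> 0" unfolding E_def by (rule Bochner_Integration.integral_nonneg) simp
  then obtain G where G: "G \<in> sets D" "measure D G \<le> exp (- E\<^sup>2 / (128 * (1 / n1 + 1 / n2)))"
      "\<And>z. z \<in> space D - G \<Longrightarrow> E / 2 < Ed2 \<nu> n1 n2 z"
    using Ed2_lower_tail[OF n P Q \<nu>] unfolding D_def E_def by blast
  define e where "e = exp (- \<alpha>\<^sup>2 * B / 2)"
  define X where "X = {(z, ps) \<in> space (D \<Otimes>\<^sub>M perms_law n B). perm_test n1 n2 B \<alpha> \<nu> z ps = 0}"
  have slice: "emeasure (perms_law n B) (Pair z -` X) \<le> ennreal e" if z: "z \<in> space D - G" for z
  proof -
    define H where "H = {p \<in> S. Ed2 \<nu> n1 n2 (z \<circ> p) < Ed2 \<nu> n1 n2 z}"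
    have "card (S - H) / fact n \<le> card {p. p permutes {1..n} \<and> Ed2 \<nu> n1 n2 (z \<circ> p) \<ge> 4 / m + (E / 2 - 4 / m)} / fact (card {1..n})"
      using G(3)[OF z] S(1)
      by (auto intro!: divide_right_mono card_mono simp: S_def H_def)
    also have "\<dots> \<le> exp (- (E / 2 - 4 / m)\<^sup>2 / (2 * card {1..n} * (16 / m)\<^sup>2))"
    proof (rule permutation_tail)
      show "(\<Sum>p | p permutes {1..n}. Ed2 \<nu> n1 n2 (z \<circ> p)) / fact (card {1..n}) \<le> 4 / m"
        using mean_permuted_Ed2_le[OF n \<nu>] by (simp add: n_def m_def)
      show "\<bar>Ed2 \<nu> n1 n2 (z \<circ> (swap x y \<circ> p)) - Ed2 \<nu> n1 n2 (z \<circ> p)\<bar> \<le> 16 / m"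
        if "p permutes {1..n}" for p x y
        using Ed2_swap_diff_le[OF n \<nu>] that by (simp add: n_def m_def)
    qed (use n m E in \<open>auto simp: n_def\<close>)
    also have "\<dots> \<le> \<alpha> / 2" using \<alpha> by (simp add: n_def)
    also have "real (card (S - H)) = fact n - real (card H)"
      using S card_mono[of S H] by (subst card_Diff_subset) (auto simp: H_def of_nat_diff)
    finally have H: "card H / fact n \<ge> 1 - \<alpha> / 2"
      by (simp add: diff_divide_distrib)
    have "Pair z -` X \<subseteq> {ps \<in> space (perms_law n B). (\<Sum>b\<in>{1..B}. indicator H (ps b)) \<le> (1 - \<alpha>) * B}"
    proof
      fix ps assume "ps \<in> Pair z -` X"
      then have ps: "ps \<in> space (perms_law n B)" and acc: "perm_test n1 n2 B \<alpha> \<nu> z ps = 0"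
        by (auto simp: X_def space_pair_measure)
      have "ps b \<in> S" if "b \<in> {1..B}" for b
        using ps that by (auto simp: perms_law_def space_PiM space_uniform_count_measure S_def)
      then have "(\<Sum>b\<in>{1..B}. if Ed2_perm \<nu> n1 n2 z (ps b) < Ed2 \<nu> n1 n2 z then 1 else 0)
          = (\<Sum>b\<in>{1..B}. indicator H (ps b) :: real)"
        by (intro sum.cong refl) (auto simp: H_def Ed2_perm_conv_Ed2 indicator_def)
      then have "1 / real B * (\<Sum>b\<in>{1..B}. indicator H (ps b)) \<le> 1 - \<alpha>"
        using acc by (simp add: perm_test_def split: if_splits)
      then show "ps \<in> {ps \<in> space (perms_law n B). (\<Sum>b\<in>{1..B}. indicator H (ps b)) \<le> (1 - \<alpha>) * B}"
        using ps \<open>B \<ge> 1\<close> by (simp add: field_simps)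
    qed
    moreover have "{ps \<in> space (perms_law n B). (\<Sum>b\<in>{1..B}. indicator H (ps b)) \<le> (1 - \<alpha>) * B} \<in> sets (perms_law n B)"
    proof -
      have [measurable]: "indicator H \<in> borel_measurable (uniform_count_measure S)"
        by (intro borel_measurable_indicator) (auto simp: sets_uniform_count_measure H_def)
      show ?thesis unfolding perms_law_def S_def[symmetric] by measurable
    qed
    ultimately have "emeasure (perms_law n B) (Pair z -` X) \<le> emeasure (perms_law n B)
        {ps \<in> space (perms_law n B). (\<Sum>b\<in>{1..B}. indicator H (ps b)) \<le> (1 - \<alpha>) * B}"
      by (rule emeasure_mono)
    also have "\<dots> \<le> ennreal e"
      unfolding R.emeasure_eq_measure e_def
      by (intro ennreal_leI perms_law_few_hits[OF \<open>B \<ge> 1\<close> \<open>\<alpha> \<ge> 0\<close> _ H]) (auto simp: H_def S_def)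
    finally show ?thesis .
  qed
  have "emeasure (D \<Otimes>\<^sub>M perms_law n B) X \<le> ennreal (measure D G + e)"
  \<comment> \<open>A set that is not measurable has \<open>emeasure\<close> zero, so only the measurable case needs an argument.\<close>
  proof (cases "X \<in> sets (D \<Otimes>\<^sub>M perms_law n B)")
    case True
    have "emeasure (D \<Otimes>\<^sub>M perms_law n B) X = (\<integral>\<^sup>+z. emeasure (perms_law n B) (Pair z -` X) \<partial>D)"
      by (rule R.emeasure_pair_measure_alt[OF True])
    also have "\<dots> \<le> (\<integral>\<^sup>+z. indicator G z + ennreal e \<partial>D)"
    proof (rule nn_integral_mono)
      fix z assume "z \<in> space D"
      then show "emeasure (perms_law n B) (Pair z -` X) \<le> indicator G z + ennreal e"
        using slice[of z] R.emeasure_le_1[of "Pair z -` X"]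
        by (cases "z \<in> G") (auto intro: order_trans[of _ 1] add_increasing2)
    qed
    also have "\<dots> = emeasure D G + ennreal e"
      using G(1) by (simp add: nn_integral_add D.emeasure_space_1)
    also have "\<dots> = ennreal (measure D G + e)"
      by (simp add: D.emeasure_eq_measure e_def)
    finally show ?thesis .
  next
    case False
    then show ?thesis by (simp add: emeasure_notin_sets)
  qed
  also have "\<dots> \<le> ennreal (exp (- E\<^sup>2 / (128 * (1 / n1 + 1 / n2))) + e)"
    using G(2) by (intro ennreal_leI) simp
  finally show ?thesis
    by (simp add: perm_test_error_def X_def D_def n_def e_def Let_def)
qed

lemma separation_rate_leI:
  assumes "\<rho> > 0" and "\<And>\<nu> P Q. \<nu> \<in> weighting_measures \<Longrightarrow> (P, Q) \<in> alternatives \<nu> \<rho> \<Longrightarrow> err \<nu> P Q \<le> ennreal \<beta>"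
  shows "separation_rate err \<beta> \<le> ereal \<rho>"
  unfolding separation_rate_def using assms
  by (intro INF_lower) (auto intro!: SUP_least)

text \<open>With \<open>n = n1 + n2\<close>, \<open>L = ln (1/\<alpha>) + ln (1/\<beta>)\<close> and \<open>C = 1 + 1/c1 + c2\<close>, the smaller sample has at
  least \<open>n/C\<close> elements. If \<open>E \<ge> 72 C n powr (-1/2) L\<close>, both the concentration over permutations and
  the one over the data have exponents of at least \<open>2 L\<^sup>2 \<ge> 2 L\<close>, where \<open>L \<ge> 1\<close> comes from
  \<open>\<beta> < 1/e\<close>. As \<open>exp (-L) = \<alpha> \<beta>\<close>, the error probabilities come out as at most \<open>\<alpha>/2\<close> and \<open>\<beta>/2\<close>.
  The constant \<open>72\<close> is \<open>2 * (4 + 32)\<close>: the \<open>4\<close> absorbs the mean of the permuted statistic, and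
  \<open>32\<close> is what the exponent requires.\<close>

lemma separation_rate_perm_test_le:
  fixes c1 c2 \<alpha> \<beta> :: real
  assumes n: "n1 \<ge> 1" "n2 \<ge> 1" and c: "c1 > 0" "c2 > 0"
    and ratio: "c1 \<le> real n1 / real n2" "real n1 / real n2 \<le> c2"
    and \<alpha>: "0 < \<alpha>" "\<alpha> < 1" and \<beta>: "0 < \<beta>" "\<beta> < 1 / exp 1"
    and B: "real B \<ge> 2 * \<alpha> powi (-2) * ln (6 / \<beta>)"
  shows "separation_rate
      (perm_test_error n1 n2 B \<alpha> :: 'a::{real_inner, polish_space} measure \<Rightarrow> 'a measure \<Rightarrow> 'a measure \<Rightarrow> ennreal) \<beta>
    \<le> ereal (72 * (1 + 1 / c1 + c2) * real (n1 + n2) powr (- 1 / 2) * (ln (1 / \<alpha>) + ln (1 / \<beta>)))"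
proof -
  define C where "C = 1 + 1 / c1 + c2"
  define L where "L = ln (1 / \<alpha>) + ln (1 / \<beta>)"
  define n where "n = real (n1 + n2)"
  define q where "q = n powr (- 1 / 2)"
  define m where "m = real (min n1 n2)"
  define \<rho> where "\<rho> = 72 * C * q * L"
  have C: "C \<ge> 1" using c by (simp add: C_def)
  have n1: "n \<ge> 1" and m: "m \<ge> 1" using n by (auto simp: n_def m_def)
  have nm: "n \<le> C * m"
  proof -
    have "n2 \<le> n1 / c1" "n1 \<le> c2 * n2" using ratio c n by (auto simp: field_simps)
    moreover have "0 \<le> n1 / c1" "0 \<le> c2 * n1" "0 \<le> n2 / c1" "0 \<le> c2 * n2" using c by auto
    ultimately have "n \<le> C * n1" "n \<le> C * n2"
      by (auto simp: C_def n_def algebra_simps)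
    then show ?thesis by (auto simp: m_def min_def)
  qed
  have inv_m: "1 / m \<le> C / n" using nm n1 m by (simp add: field_simps)
  have q: "q > 0" "q\<^sup>2 = 1 / n" "1 / n \<le> q"
  proof -
    show "q > 0" using n1 by (simp add: q_def)
    have "q\<^sup>2 = n powr (- 1 / 2 + - 1 / 2)"
      unfolding q_def power2_eq_square powr_add ..
    also have "\<dots> = 1 / n" using n1 by (simp add: powr_minus_divide)
    finally show q2: "q\<^sup>2 = 1 / n" .
    have "q\<^sup>2 \<le> 1\<^sup>2" unfolding q2 using n1 by simp
    then have "q \<le> 1" by (rule power2_le_imp_le) simp
    then have "q * q \<le> q * 1" using \<open>q > 0\<close> by (intro mult_left_mono) auto
    then show "1 / n \<le> q" using q2 by (simp add: power2_eq_square)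
  qed
  have expL: "exp (- L) = \<alpha> * \<beta>" using \<alpha> \<beta> by (simp add: L_def ln_div exp_add)
  have "exp 1 \<ge> (2::real)" using exp_ge_add_one_self[of 1] by simp
  then have "1 / exp 1 \<le> (1::real) / 2" by (intro divide_left_mono) auto
  then have \<beta>2: "\<beta> < 1 / 2" using \<beta>(2) by linarith
  have "1 \<le> ln (1 / \<beta>)" using \<beta> by (subst ln_ge_iff) (auto simp: field_simps)
  moreover have "0 < ln (1 / \<alpha>)" using \<alpha> by (simp add: ln_div)
  ultimately have L: "L \<ge> 1" by (simp add: L_def)
  have LL: "L \<le> L\<^sup>2" using L mult_left_mono[of 1 L L] by (simp add: power2_eq_square)
  have exp2L: "exp (- (2 * L\<^sup>2)) \<le> \<alpha> * \<beta> * (\<alpha> * \<beta>)"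
  proof -
    have "exp (- (2 * L\<^sup>2)) \<le> exp (- L + - L)" using LL by simp
    then show ?thesis unfolding exp_add expL .
  qed
  have "\<alpha> * \<beta> * (\<alpha> * \<beta>) \<le> \<alpha> * 1 * (1 * (1 / 2))" "\<alpha> * \<beta> * (\<alpha> * \<beta>) \<le> 1 * \<beta> * (1 * (1 / 2))"
    using \<alpha> \<beta> \<beta>2 by (intro mult_mono; simp)+
  then have exp_\<alpha>: "exp (- (2 * L\<^sup>2)) \<le> \<alpha> / 2" and exp_\<beta>: "exp (- (2 * L\<^sup>2)) \<le> \<beta> / 2"
    using exp2L by auto
  have "ln (6 / \<beta>) > 0" using \<beta> \<beta>2 by (intro ln_gt_zero) (auto simp: field_simps)
  then have "real B > 0" using B \<alpha> by (intro less_le_trans[OF _ B]) auto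
  then have B1: "B \<ge> 1" by simp
  have "2 * ln (6 / \<beta>) \<le> \<alpha>\<^sup>2 * B"
    using B \<alpha> by (simp add: power_int_minus field_simps)
  then have "exp (- \<alpha>\<^sup>2 * B / 2) \<le> exp (- ln (6 / \<beta>))" by simp
  also have "\<dots> = \<beta> / 6" using \<beta> by (simp add: exp_minus)
  finally have exp_B: "exp (- \<alpha>\<^sup>2 * B / 2) \<le> \<beta> / 6" .
  have "separation_rate (perm_test_error n1 n2 B \<alpha> :: 'a measure \<Rightarrow> 'a measure \<Rightarrow> 'a measure \<Rightarrow> ennreal) \<beta> \<le> ereal \<rho>"
  proof (rule separation_rate_leI)
    show "\<rho> > 0" using C q L by (simp add: \<rho>_def)
    fix \<nu> P Q :: "'a measure"
    assume \<nu>: "\<nu> \<in> weighting_measures" and PQ: "(P, Q) \<in> alternatives \<nu> \<rho>"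
    define E where "E = (LINT w|\<nu>. (cmod (char_fun P w - char_fun Q w))\<^sup>2)"
    have E: "E \<ge> 72 * C * q * L" and meas: "P \<in> borel_prob" "Q \<in> borel_prob" "\<nu> \<in> borel_prob"
      using \<nu> PQ by (auto simp: alternatives_def weighting_measures_def E_def \<rho>_def)
    have "4 / m \<le> 4 * (C * q)"
      using inv_m mult_left_mono[OF q(3), of C] C by simp
    also have "\<dots> \<le> 4 * (C * q) * L" using C q L by simp
    finally have gap: "E / 2 - 4 / m \<ge> 32 * C * q * L" using E by simp
    have pos: "C * q * L > 0" using C q L by simp
    have gap2: "(E / 2 - 4 / m)\<^sup>2 \<ge> 1024 * C\<^sup>2 * L\<^sup>2 / n"
    proof -
      have "(32 * C * q * L)\<^sup>2 \<le> (E / 2 - 4 / m)\<^sup>2" using gap C q L by (intro power_mono mult_nonneg_nonneg) auto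
      then show ?thesis by (simp add: power_mult_distrib q)
    qed
    have E2: "E\<^sup>2 \<ge> 5184 * C\<^sup>2 * L\<^sup>2 / n"
    proof -
      have "(72 * C * q * L)\<^sup>2 \<le> E\<^sup>2" using E C q L by (intro power_mono mult_nonneg_nonneg) auto
      then show ?thesis by (simp add: power_mult_distrib q)
    qed
    have exp1: "exp (- (E / 2 - 4 / m)\<^sup>2 / (2 * real (n1 + n2) * (16 / m)\<^sup>2)) \<le> \<alpha> / 2"
    proof -
      have "2 * n * (16 / m)\<^sup>2 = 512 * n * (1 / m)\<^sup>2" by (simp add: power_divide)
      also have "\<dots> \<le> 512 * n * (C / n)\<^sup>2" using inv_m m n1 by (intro mult_left_mono power_mono) auto
      also have "\<dots> = 512 * C\<^sup>2 / n" using n1 by (simp add: power2_eq_square)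
      finally have "2 * L\<^sup>2 * (2 * n * (16 / m)\<^sup>2) \<le> 2 * L\<^sup>2 * (512 * C\<^sup>2 / n)"
        by (intro mult_left_mono) auto
      also have "\<dots> \<le> (E / 2 - 4 / m)\<^sup>2" using gap2 by (simp add: mult_ac)
      finally have "2 * L\<^sup>2 \<le> (E / 2 - 4 / m)\<^sup>2 / (2 * n * (16 / m)\<^sup>2)"
        using n1 m by (subst pos_le_divide_eq) auto
      then show ?thesis using exp_\<alpha> by (intro order_trans[OF _ exp_\<alpha>]) (simp add: n_def)
    qed
    have exp2: "exp (- E\<^sup>2 / (128 * (1 / n1 + 1 / n2))) \<le> \<beta> / 2"
    proof -
      have "1 / n1 + 1 / n2 \<le> 1 / m + 1 / m"
        using n by (intro add_mono) (auto simp: m_def field_simps)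
      also have "\<dots> \<le> 2 * (C / n)" using inv_m by simp
      finally have "2 * L\<^sup>2 * (128 * (1 / n1 + 1 / n2)) \<le> 2 * L\<^sup>2 * (128 * (2 * (C / n)))"
        by (intro mult_left_mono) auto
      also have "\<dots> = 512 * L\<^sup>2 / n * C" by simp
      also have "\<dots> \<le> 512 * L\<^sup>2 / n * C\<^sup>2"
        using C n1 by (intro mult_left_mono) (auto simp: power2_eq_square)
      also have "\<dots> \<le> 5184 * L\<^sup>2 / n * C\<^sup>2"
        using n1 by (intro mult_right_mono divide_right_mono) auto
      also have "\<dots> \<le> E\<^sup>2" using E2 by (simp add: mult_ac)
      finally have "2 * L\<^sup>2 \<le> E\<^sup>2 / (128 * (1 / n1 + 1 / n2))"
        using n by (subst pos_le_divide_eq) (auto intro!: add_pos_pos)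
      then show ?thesis by (intro order_trans[OF _ exp_\<beta>]) simp
    qed
    have "perm_test_error n1 n2 B \<alpha> \<nu> P Q
        \<le> ennreal (exp (- E\<^sup>2 / (128 * (1 / n1 + 1 / n2))) + exp (- \<alpha>\<^sup>2 * B / 2))"
      using exp1 gap pos \<alpha> unfolding E_def m_def
      by (intro perm_test_error_le n meas B1) auto
    also have "\<dots> \<le> ennreal \<beta>" using exp2 exp_B \<beta> by (intro ennreal_leI) simp
    finally show "perm_test_error n1 n2 B \<alpha> \<nu> P Q \<le> ennreal \<beta>" .
  qed
  then show ?thesis by (simp add: \<rho>_def C_def L_def q_def n_def)
qed

section \<open>Weighting measures and discrete alternatives\<close>

text \<open>Gram-Schmidt: the span of finitely many vectors misses some \<open>v\<close>, and the component of \<open>v\<close> orthogonal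
  to them, normalized, extends the family.\<close>

lemma orthonormal_family_exists:
  assumes infinite_dim: "\<And>S :: 'a::real_inner set. finite S \<Longrightarrow> span S \<noteq> UNIV"
  shows "\<exists>e :: nat \<Rightarrow> 'a. \<forall>i<N. \<forall>j<N. e i \<bullet> e j = (if i = j then 1 else 0)"
proof (induction N)
  case 0
  then show ?case by simp
next
  case (Suc N)
  then obtain e :: "nat \<Rightarrow> 'a" where e: "\<And>i j. i < N \<Longrightarrow> j < N \<Longrightarrow> e i \<bullet> e j = (if i = j then 1 else 0)"
    by blast
  obtain v where v: "v \<notin> span (e ` {..<N})" using infinite_dim[of "e ` {..<N}"] by auto
  define u where "u = v - (\<Sum>i<N. (v \<bullet> e i) *\<^sub>R e i)"
  have "(\<Sum>i<N. (v \<bullet> e i) *\<^sub>R e i) \<in> span (e ` {..<N})"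
    by (intro span_sum span_scale span_base) auto
  then have "u \<noteq> 0" using v by (auto simp: u_def)
  have orth: "u \<bullet> e j = 0" if "j < N" for j
  proof -
    have "(\<Sum>i<N. (v \<bullet> e i) * (e i \<bullet> e j)) = (\<Sum>i<N. if i = j then v \<bullet> e i else 0)"
      using that by (intro sum.cong refl) (auto simp: e)
    then show ?thesis using that by (simp add: u_def inner_diff_left inner_sum_left)
  qed
  define e' where "e' = e(N := u /\<^sub>R norm u)"
  have "e' N \<bullet> e' N = 1"
    using \<open>u \<noteq> 0\<close> by (simp add: e'_def dot_square_norm power2_eq_square)
  moreover have "e' N \<bullet> e' j = 0" "e' j \<bullet> e' N = 0" if "j < N" for j
    using orth[OF that] that by (auto simp: e'_def inner_commute[of _ u])
  moreover have "e' i \<bullet> e' j = (if i = j then 1 else 0)" if "i < N" "j < N" for i j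
    using e that by (simp add: e'_def)
  ultimately have "e' i \<bullet> e' j = (if i = j then 1 else 0)" if "i < Suc N" "j < Suc N" for i j
    using that by (auto simp: less_Suc_eq)
  then show ?case by blast
qed

lemma borel_prob_distr_pmf:
  fixes g :: "'b \<Rightarrow> 'a::topological_space"
  shows "distr (measure_pmf p) borel g \<in> borel_prob"
  by (auto simp: borel_prob_def intro!: measure_pmf.prob_space_distr)

text \<open>Half of the mass sits on \<open>w\<close>; the other half is spread over a countable dense set, which makes the
  support everything. A random sign makes the law symmetric.\<close>

lemma weighting_measure_with_atoms_exists:
  fixes w :: "'a::{real_inner, polish_space}"
  shows "\<exists>\<nu> \<in> weighting_measures. measure \<nu> {w, - w} \<ge> 1 / 2"
proof -
  obtain D :: "'a set" where D: "countable D" "\<And>X. open X \<Longrightarrow> X \<noteq> {} \<Longrightarrow> \<exists>d\<in>D. d \<in> X"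
    using countable_dense_setE by blast
  have "D \<noteq> {}" using D(2)[OF open_UNIV] by auto
  define x where "x = from_nat_into D"
  define coin where "coin = bernoulli_pmf (1 / 2)"
  define r where "r = map_pmf (\<lambda>(b, k). if b then w else x k) (pair_pmf coin (geometric_pmf (1 / 2)))"
  define p where "p = map_pmf (\<lambda>(s, y). if s then y else - y) (pair_pmf coin r)"
  define \<nu> where "\<nu> = distr (measure_pmf p) borel (\<lambda>y. y)"
  have \<nu>: "emeasure \<nu> A = emeasure p A" if "A \<in> sets borel" for A
    using that by (simp add: \<nu>_def emeasure_distr)
  have "map_pmf Not coin = coin"
  proof (rule pmf_eqI)
    fix b
    have "Not -` {b} = {\<not> b}" by auto
    then show "pmf (map_pmf Not coin) b = pmf coin b"
      by (cases b) (simp_all add: coin_def pmf_map measure_pmf_single)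
  qed
  then have "map_pmf (\<lambda>(s, y). (\<not> s, y)) (pair_pmf coin r) = pair_pmf coin r"
    using map_pair[of Not "\<lambda>y. y" coin r] by simp
  then have "p = map_pmf (\<lambda>(s, y). if s then y else - y) (map_pmf (\<lambda>(s, y). (\<not> s, y)) (pair_pmf coin r))"
    by (simp add: p_def)
  also have "\<dots> = map_pmf uminus p"
    unfolding p_def map_pmf_comp by (intro map_pmf_cong) auto
  finally have sym_p: "p = map_pmf uminus p" .
  have sym: "emeasure \<nu> A = emeasure \<nu> (uminus ` A)" if A: "A \<in> sets borel" for A
  proof -
    have vim: "uminus -` A = uminus ` A" for A :: "'a set" by force
    have "uminus -` A \<inter> space borel \<in> sets borel"
      using A by (intro measurable_sets[of _ borel borel]) auto
    then have "uminus ` A \<in> sets borel" by (simp add: vim)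
    then show ?thesis using A sym_p \<nu> emeasure_map_pmf[of uminus p A] by (simp add: vim)
  qed
  have "y \<in> measure_support \<nu>" for y
    unfolding measure_support_def
  proof safe
    fix U :: "'a set" assume U: "open U" "y \<in> U"
    then obtain d where d: "d \<in> D" "d \<in> U" using D(2)[of U] by auto
    obtain k where k: "d = x k"
      using d(1) D(1) by (metis x_def from_nat_into_surj)
    have "d \<in> set_pmf r"
      using k by (auto simp: r_def coin_def set_pmf_geometric image_iff Bex_def intro!: exI[of _ False])
    then have "d \<in> set_pmf p"
      by (auto simp: p_def coin_def image_iff Bex_def intro!: exI[of _ True])
    then have "0 < ennreal (pmf p d)" by (simp add: pmf_positive)
    also have "\<dots> \<le> emeasure p U"
      unfolding emeasure_pmf_single[symmetric] using d(2) by (intro emeasure_mono) auto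
    finally have "emeasure p U > 0" .
    then show "emeasure \<nu> U > 0" using \<nu> U by simp
  qed
  then have "\<nu> \<in> weighting_measures"
    using sym by (auto simp: weighting_measures_def \<nu>_def borel_prob_distr_pmf)
  moreover have "measure \<nu> {w, - w} \<ge> 1 / 2"
  proof -
    have "1 / 2 = measure_pmf.prob (map_pmf fst (pair_pmf coin (geometric_pmf (1 / 2)))) {True}"
      unfolding map_fst_pair_pmf by (simp add: coin_def measure_pmf_single)
    also have "\<dots> \<le> measure_pmf.prob r {w}"
      unfolding r_def measure_map_pmf by (intro measure_pmf.finite_measure_mono) auto
    also have "\<dots> = measure_pmf.prob (map_pmf snd (pair_pmf coin r)) {w}"
      unfolding map_snd_pair_pmf ..
    also have "\<dots> \<le> measure_pmf.prob p {w, - w}"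
      unfolding p_def measure_map_pmf by (intro measure_pmf.finite_measure_mono) auto
    also have "\<dots> = measure \<nu> {w, - w}" by (simp add: measure_def \<nu>)
    finally show ?thesis .
  qed
  ultimately show ?thesis by blast
qed

lemma char_fun_distr_pmf_const:
  fixes g :: "'b \<Rightarrow> 'a::{real_inner, polish_space}"
  assumes "\<And>i. i \<in> set_pmf p \<Longrightarrow> cis (w \<bullet> g i) = c"
  shows "char_fun (distr (measure_pmf p) borel g) w = c"
proof -
  have "char_fun (distr (measure_pmf p) borel g) w = (LINT i|measure_pmf p. cis (w \<bullet> g i))"
    unfolding char_fun_conv_cis by (intro integral_distr) auto
  also have "\<dots> = (LINT i|measure_pmf p. c)"
    using assms by (intro integral_cong_AE) (auto simp: AE_measure_pmf_iff)
  finally show ?thesis by simp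
qed

text \<open>The two uniform laws live on disjoint orthonormal sets of \<open>m\<close> vectors each. For \<open>w\<close> equal to \<open>\<pi>\<close> times
  the sum of the second set, all inner products with the first set are \<open>0\<close> and all those with the
  second set are \<open>\<pi>\<close>, so the characteristic functions are \<open>1\<close> and \<open>-1\<close> at \<open>w\<close> and at \<open>-w\<close>.\<close>

lemma orthonormal_halves_in_alternatives:
  fixes v :: "nat \<Rightarrow> bool \<Rightarrow> 'a::{real_inner, polish_space}"
  assumes orth: "\<And>i j b c. i < m \<Longrightarrow> j < m \<Longrightarrow> v i b \<bullet> v j c = (if i = j \<and> b = c then 1 else 0)"
    and "m > 0" "\<rho> \<le> 2"
  defines "U \<equiv> pmf_of_set {..<m}"
  shows "\<exists>\<nu> \<in> weighting_measures.
    (distr (measure_pmf U) borel (\<lambda>i. v i (s i)), distr (measure_pmf U) borel (\<lambda>i. v i (\<not> s i)))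
      \<in> alternatives \<nu> \<rho>"
proof -
  let ?P = "distr (measure_pmf U) borel (\<lambda>i. v i (s i))"
  let ?Q = "distr (measure_pmf U) borel (\<lambda>i. v i (\<not> s i))"
  \<comment> \<open>The direction in which the characters of the first set are \<open>1\<close> and those of the second are \<open>-1\<close>.\<close>
  define w where "w = (\<Sum>j<m. pi *\<^sub>R v j (\<not> s j))"
  have set_U: "set_pmf U = {..<m}" unfolding U_def using \<open>m > 0\<close> by (intro set_pmf_of_set) auto
  have w_P: "w \<bullet> v i (s i) = 0" if "i < m" for i
    unfolding w_def inner_sum_left using that by (intro sum.neutral) (auto simp: orth)
  have w_Q: "w \<bullet> v i (\<not> s i) = pi" if "i < m" for i
  proof -
    have "w \<bullet> v i (\<not> s i) = (\<Sum>j<m. if j = i then pi else 0)"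
      unfolding w_def inner_sum_left using that by (intro sum.cong) (auto simp: orth)
    then show ?thesis using that by simp
  qed
  have P: "?P \<in> borel_prob" "?Q \<in> borel_prob" by (rule borel_prob_distr_pmf)+
  have "char_fun ?P y = 1" "char_fun ?Q y = - 1" if "y \<in> {w, - w}" for y
    using that by (intro char_fun_distr_pmf_const; auto simp: set_U w_P w_Q complex_eq_iff)+
  then have four: "(cmod (char_fun ?P y - char_fun ?Q y))\<^sup>2 = 4" if "y \<in> {w, - w}" for y
    using that by auto
  obtain \<nu> where \<nu>: "\<nu> \<in> weighting_measures" "measure \<nu> {w, - w} \<ge> 1 / 2"
    using weighting_measure_with_atoms_exists by blast
  then have \<nu>_prob: "\<nu> \<in> borel_prob" by (simp add: weighting_measures_def)
  interpret V: prob_space \<nu> using borel_probD(1)[OF \<nu>_prob] .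
  have [measurable_cong]: "sets \<nu> = sets borel" using borel_probD(2)[OF \<nu>_prob] .
  note [measurable] = borel_measurable_char_fun[OF P(1)] borel_measurable_char_fun[OF P(2)]
  have W [measurable]: "{w, - w} \<in> sets \<nu>" by simp
  have "cmod (char_fun ?P y - char_fun ?Q y) \<le> 2" for y
    using norm_triangle_ineq4[of "char_fun ?P y" "char_fun ?Q y"] cmod_char_fun_le_1[OF P(1), of y]
      cmod_char_fun_le_1[OF P(2), of y] by simp
  then have le4: "(cmod (char_fun ?P y - char_fun ?Q y))\<^sup>2 \<le> 4" for y
    using power_mono[of "cmod (char_fun ?P y - char_fun ?Q y)" 2 2] by simp
  have "2 \<le> 4 * measure \<nu> {w, - w}" using \<nu>(2) by simp
  also have "\<dots> = (LINT y|\<nu>. 4 * indicator {w, - w} y)"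
    using borel_probD(3)[OF \<nu>_prob] by simp
  also have "\<dots> \<le> (LINT y|\<nu>. (cmod (char_fun ?P y - char_fun ?Q y))\<^sup>2)"
  proof (rule integral_mono)
    show "integrable \<nu> (\<lambda>y. 4 * indicator {w, - w} y :: real)"
      by (rule V.integrable_const_bound[where B = 4]) (auto simp: indicator_def)
    show "integrable \<nu> (\<lambda>y. (cmod (char_fun ?P y - char_fun ?Q y))\<^sup>2)"
      by (rule V.integrable_const_bound[where B = 4]) (use le4 in auto)
    show "4 * indicator {w, - w} y \<le> (cmod (char_fun ?P y - char_fun ?Q y))\<^sup>2" for y
      using four[of y] by (auto simp: indicator_def)
  qed
  finally show ?thesis
    using \<nu>(1) P \<open>\<rho> \<le> 2\<close> by (intro bexI[of _ \<nu>]) (auto simp: alternatives_def)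
qed

text \<open>For discrete laws the law of the data can be handled as a probability mass function.\<close>

lemma emeasure_data_law_distr_pmf:
  fixes g h :: "'b \<Rightarrow> 'a::{real_inner, polish_space}"
  defines "X \<equiv> (\<lambda>n1 n2 f. \<lambda>j\<in>{1..n1 + n2}. if j \<le> n1 then g (f j) else h (f j))"
  assumes "n1 \<ge> 1" and A: "A \<in> sets (PiM {1..n1 + n2} (\<lambda>_. borel))"
  shows "emeasure (data_law n1 n2 (distr (measure_pmf p) borel g) (distr (measure_pmf p) borel h)) A
    = emeasure (map_pmf (X n1 n2) (Pi_pmf {1..n1 + n2} d (\<lambda>_. p))) A"
proof -
  define I where "I = {1..n1 + n2}"
  define G where "G j = (if j \<le> n1 then g else h)" for j
  let ?pp = "Pi_pmf I d (\<lambda>_. p)"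
  have "I \<noteq> {}" "finite I" using \<open>n1 \<ge> 1\<close> by (auto simp: I_def)
  have ind: "prob_space.indep_vars (measure_pmf ?pp) (\<lambda>_. borel) (\<lambda>j f. G j (f j)) I"
    by (rule prob_space.indep_vars_compose2[OF measure_pmf.prob_space_axioms indep_vars_Pi_pmf[OF \<open>finite I\<close>]]) auto
  have "data_law n1 n2 (distr (measure_pmf p) borel g) (distr (measure_pmf p) borel h)
      = PiM I (\<lambda>j. distr (measure_pmf ?pp) borel (\<lambda>f. G j (f j)))"
    unfolding data_law_def I_def[symmetric]
  proof (intro PiM_cong refl)
    fix j assume j: "j \<in> I"
    have "distr (measure_pmf ?pp) borel (\<lambda>f. G j (f j))
        = distr (measure_pmf (map_pmf (\<lambda>f. f j) ?pp)) borel (G j)"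
      unfolding map_pmf_rep_eq by (subst distr_distr) (auto simp: o_def)
    also have "map_pmf (\<lambda>f. f j) ?pp = p"
      using j \<open>finite I\<close> by (subst Pi_pmf_component) auto
    finally show "(if j \<le> n1 then distr (measure_pmf p) borel g else distr (measure_pmf p) borel h)
        = distr (measure_pmf ?pp) borel (\<lambda>f. G j (f j))"
      by (simp add: G_def)
  qed
  also have "\<dots> = distr (measure_pmf ?pp) (PiM I (\<lambda>_. borel)) (\<lambda>f. \<lambda>j\<in>I. G j (f j))"
    using ind by (subst (asm) prob_space.indep_vars_iff_distr_eq_PiM'[OF measure_pmf.prob_space_axioms \<open>I \<noteq> {}\<close>]) auto
  finally have law: "data_law n1 n2 (distr (measure_pmf p) borel g) (distr (measure_pmf p) borel h)
      = distr (measure_pmf ?pp) (PiM I (\<lambda>_. borel)) (\<lambda>f. \<lambda>j\<in>I. G j (f j))" .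
  have "(\<lambda>f. \<lambda>j\<in>I. G j (f j)) \<in> measurable (measure_pmf ?pp) (PiM I (\<lambda>_. borel))"
    by (rule measurable_restrict) simp
  from emeasure_distr[OF this A[folded I_def]]
  have "emeasure (data_law n1 n2 (distr (measure_pmf p) borel g) (distr (measure_pmf p) borel h)) A
      = emeasure (measure_pmf ?pp) ((\<lambda>f. \<lambda>j\<in>I. G j (f j)) -` A)"
    unfolding law by simp
  also have "(\<lambda>f. \<lambda>j\<in>I. G j (f j)) = X n1 n2"
    by (auto simp: X_def I_def G_def fun_eq_iff restrict_def)
  finally show ?thesis by (simp add: I_def)
qed

section \<open>Indistinguishability of the mixture from a null law\<close>

text \<open>Coins that are read off at distinct places are independent and fair, even if some of them,
  prescribed by \<open>c\<close>, are flipped afterwards.\<close>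

lemma fresh_coins:
  assumes "finite I" "finite M" "inj_on f I" "f ` I \<subseteq> M"
  defines "coin \<equiv> bernoulli_pmf (1 / 2)"
  shows "map_pmf (\<lambda>s j. if j \<in> I then s (f j) \<noteq> c j else False) (Pi_pmf M False (\<lambda>_. coin))
    = Pi_pmf I False (\<lambda>_. coin)" (is "map_pmf ?h _ = _")
proof (rule pmf_eqI)
  fix t :: "'a \<Rightarrow> bool"
  have coin: "measure_pmf.prob coin {b} = 1 / 2" for b
    by (cases b) (simp_all add: coin_def measure_pmf_single)
  then have pmf_coin: "pmf coin b = 1 / 2" for b by (simp add: measure_pmf_single)
  show "pmf (map_pmf ?h (Pi_pmf M False (\<lambda>_. coin))) t = pmf (Pi_pmf I False (\<lambda>_. coin)) t"
  proof (cases "\<forall>j. j \<notin> I \<longrightarrow> \<not> t j")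
    case False
    then have "?h -` {t} = {}" by (auto simp: fun_eq_iff)
    then show ?thesis using False \<open>finite I\<close> by (auto simp: pmf_map pmf_Pi)
  next
    case True
    \<comment> \<open>The constraint that the event \<open>?h s = t\<close> puts on the coin at place \<open>x\<close>.\<close>
    define K where "K x = (if x \<in> f ` I then {t (the_inv_into I f x) \<noteq> c (the_inv_into I f x)} else UNIV)" for x
    have K: "K (f j) = {t j \<noteq> c j}" if "j \<in> I" for j
      using that assms(3) by (simp add: K_def the_inv_into_f_f)
    have "s \<in> ?h -` {t} \<longleftrightarrow> s \<in> Pi M K" for s
    proof -
      have "s \<in> ?h -` {t} \<longleftrightarrow> (\<forall>j\<in>I. s (f j) = (t j \<noteq> c j))"
        using True by (auto simp: fun_eq_iff)
      also have "\<dots> \<longleftrightarrow> (\<forall>x\<in>f ` I. s x \<in> K x)" using K by auto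
      also have "\<dots> \<longleftrightarrow> s \<in> Pi M K"
        using assms(4) by (auto simp: K_def Pi_def)
      finally show ?thesis .
    qed
    then have "?h -` {t} = Pi M K" by blast
    then have "pmf (map_pmf ?h (Pi_pmf M False (\<lambda>_. coin))) t = (\<Prod>x\<in>M. measure_pmf.prob coin (K x))"
      using \<open>finite M\<close> by (simp add: pmf_map measure_Pi_pmf_Pi)
    also have "\<dots> = (\<Prod>x\<in>f ` I. measure_pmf.prob coin (K x))"
      using assms by (intro prod.mono_neutral_right) (auto simp: K_def)
    also have "\<dots> = (\<Prod>x\<in>f ` I. 1 / 2)"
      by (intro prod.cong) (auto simp: K_def coin)
    also have "\<dots> = (1 / 2) ^ card I" using assms by (simp add: card_image)
    also have "\<dots> = pmf (Pi_pmf I False (\<lambda>_. coin)) t"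
      using True \<open>finite I\<close> by (simp add: pmf_Pi pmf_coin)
    finally show ?thesis .
  qed
qed

text \<open>The birthday bound: a union bound over all pairs of positions.\<close>

lemma prob_collision_le:
  fixes I :: "'i set" and d :: nat
  assumes "finite I" "m > 0"
  shows "measure_pmf.prob (Pi_pmf I d (\<lambda>_. pmf_of_set {..<m})) {f. \<not> inj_on f I} \<le> (real (card I))\<^sup>2 / m"
proof -
  let ?U = "pmf_of_set {..<m}" and ?pp = "Pi_pmf I d (\<lambda>_. pmf_of_set {..<m})"
  have set_U: "set_pmf ?U = {..<m}" using \<open>m > 0\<close> by (intro set_pmf_of_set) auto
  have pair: "measure_pmf.prob ?pp {f. f i = f j} \<le> 1 / m" if "i \<in> I" "j \<in> I" "i \<noteq> j" for i j
  proof -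
    have "measure_pmf.prob ?pp {f. f i = f j} = measure_pmf.prob ?pp (\<Union>x<m. {f. f i = x \<and> f j = x})"
      using that set_Pi_pmf[OF \<open>finite I\<close>, of d "\<lambda>_. ?U"]
      by (intro measure_pmf.finite_measure_eq_AE)
        (auto simp: AE_measure_pmf_iff PiE_dflt_def set_U)
    also have "\<dots> \<le> (\<Sum>x<m. measure_pmf.prob ?pp {f. f i = x \<and> f j = x})"
      by (intro measure_pmf.finite_measure_subadditive_finite) auto
    also have "\<dots> = (\<Sum>x<m. (1 / m)\<^sup>2)"
    proof (intro sum.cong refl)
      fix x assume x: "x \<in> {..<m}"
      have "{f. f i = x \<and> f j = x} = Pi I (\<lambda>k. if k \<in> {i, j} then {x} else UNIV)"
        using that by (auto simp: Pi_def)
      then have "measure_pmf.prob ?pp {f. f i = x \<and> f j = x}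
          = (\<Prod>k\<in>I. measure_pmf.prob ?U (if k \<in> {i, j} then {x} else UNIV))"
        using \<open>finite I\<close> by (simp add: measure_Pi_pmf_Pi)
      also have "\<dots> = (\<Prod>k\<in>{i, j}. measure_pmf.prob ?U {x})"
        using that \<open>finite I\<close> by (intro prod.mono_neutral_cong_right) auto
      also have "\<dots> = (1 / m)\<^sup>2"
        using that x \<open>m > 0\<close> by (auto simp: measure_pmf_single power2_eq_square lessThan_empty_iff)
      finally show "measure_pmf.prob ?pp {f. f i = x \<and> f j = x} = (1 / m)\<^sup>2" .
    qed
    also have "\<dots> = 1 / m" using \<open>m > 0\<close> by (simp add: power2_eq_square)
    finally show ?thesis .
  qed
  let ?J = "{(i, j). i \<in> I \<and> j \<in> I \<and> i \<noteq> j}"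
  have fin: "finite ?J" by (rule finite_subset[of _ "I \<times> I"]) (use assms in auto)
  have "measure_pmf.prob ?pp {f. \<not> inj_on f I} \<le> measure_pmf.prob ?pp (\<Union>ij\<in>?J. {f. f (fst ij) = f (snd ij)})"
    by (intro measure_pmf.finite_measure_mono) (auto simp: inj_on_def)
  also have "\<dots> \<le> (\<Sum>ij\<in>?J. measure_pmf.prob ?pp {f. f (fst ij) = f (snd ij)})"
    using fin by (intro measure_pmf.finite_measure_subadditive_finite) auto
  also have "\<dots> \<le> (\<Sum>ij\<in>?J. 1 / m)"
    by (intro sum_mono) (auto intro: pair)
  also have "\<dots> \<le> (real (card I))\<^sup>2 / m"
  proof -
    have "card ?J \<le> card I * card I"
      using card_mono[of "I \<times> I" ?J] assms by (auto simp: card_cartesian_product)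
    then have "real (card ?J) \<le> (real (card I))\<^sup>2"
      by (simp add: power2_eq_square flip: of_nat_mult)
    then show ?thesis by (simp add: divide_right_mono)
  qed
  finally show ?thesis .
qed

text \<open>This allows fixing the pair indices of all observations before their coins are tossed.\<close>

lemma Pi_pmf_pair_pmf:
  assumes "finite I"
  shows "Pi_pmf I (d, d') (\<lambda>j. pair_pmf (p j) (q j))
    = bind_pmf (Pi_pmf I d p) (\<lambda>f. map_pmf (\<lambda>g j. if j \<in> I then (f j, g j) else (d, d')) (Pi_pmf I d' q))"
proof -
  have "Pi_pmf I (d, d') (\<lambda>j. pair_pmf (p j) (q j))
      = bind_pmf (Pi_pmf I d p) (\<lambda>f. Pi_pmf I (d, d') (\<lambda>j. bind_pmf (q j) (\<lambda>y. return_pmf (f j, y))))"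
    unfolding pair_pmf_def using assms by (rule Pi_pmf_bind)
  also have "\<dots> = bind_pmf (Pi_pmf I d p) (\<lambda>f. bind_pmf (Pi_pmf I d' q)
      (\<lambda>g. Pi_pmf I (d, d') (\<lambda>j. return_pmf (f j, g j))))"
    using assms by (simp add: Pi_pmf_bind[where d' = d'])
  also have "\<dots> = bind_pmf (Pi_pmf I d p) (\<lambda>f. map_pmf (\<lambda>g j. if j \<in> I then (f j, g j) else (d, d')) (Pi_pmf I d' q))"
    using assms by (simp add: map_pmf_def)
  finally show ?thesis .
qed

text \<open>Draw the pair indices \<open>f\<close> of all observations first. Under the null law \<open>P0\<close> each observation then
  picks a member of its pair by a coin of its own; under the mixture it looks up the coin of its pair,
  flipped if the observation belongs to the second sample. By \<open>fresh_coins\<close> both procedures have the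
  same distribution if \<open>f\<close> is injective, and otherwise the trivial bound \<open>1\<close> is used. The average over
  the coins \<open>s\<close> is at most \<open>b\<close> because \<open>b\<close> bounds every single term.\<close>

lemma data_law_null_le_mixture:
  fixes v :: "nat \<Rightarrow> bool \<Rightarrow> 'a::{real_inner, polish_space}" and b :: ennreal
  defines "U \<equiv> \<lambda>m. pmf_of_set {..<m}" and "coin \<equiv> bernoulli_pmf (1 / 2)"
  assumes "n1 \<ge> 1" "m > 0" and A: "A \<in> sets (PiM {1..n1 + n2} (\<lambda>_. borel))"
    and bound: "\<And>s. emeasure (data_law n1 n2 (distr (measure_pmf (U m)) borel (\<lambda>i. v i (s i)))
      (distr (measure_pmf (U m)) borel (\<lambda>i. v i (\<not> s i)))) A \<le> b"
  defines "P0 \<equiv> distr (measure_pmf (pair_pmf (U m) coin)) borel (\<lambda>(i, c). v i c)"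
  shows "emeasure (data_law n1 n2 P0 P0) A \<le> b + ennreal ((real (n1 + n2))\<^sup>2 / m)"
proof -
  define I where "I = {1..n1 + n2}"
  define S where "S = Pi_pmf {..<m} False (\<lambda>_. coin)"
  define F where "F = Pi_pmf I 0 (\<lambda>_. U m)"
  define X where "X f t = (\<lambda>j\<in>I. v (f j) (t j))" for f :: "nat \<Rightarrow> nat" and t
  \<comment> \<open>The member of its pair that observation \<open>j\<close> picks under the alternative with coins \<open>s\<close>.\<close>
  define T where "T f s j = (if j \<in> I then s (f j) \<noteq> (n1 < j) else False)" for f :: "nat \<Rightarrow> nat" and s j
  have "finite I" by (simp add: I_def)
  have set_U: "set_pmf (U m) = {..<m}" unfolding U_def using \<open>m > 0\<close> by (intro set_pmf_of_set) auto
  have F_range: "f ` I \<subseteq> {..<m}" if "f \<in> set_pmf F" for f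
    using that set_Pi_pmf[OF \<open>finite I\<close>, of 0 "\<lambda>_. U m"] by (auto simp: F_def PiE_dflt_def set_U)
  have null: "emeasure (data_law n1 n2 P0 P0) A
      = (\<integral>\<^sup>+f. emeasure (map_pmf (X f) (Pi_pmf I False (\<lambda>_. coin))) A \<partial>F)"
  proof -
    have "emeasure (data_law n1 n2 P0 P0) A = emeasure (map_pmf (\<lambda>f. \<lambda>j\<in>I. if j \<le> n1
        then (case f j of (i, c) \<Rightarrow> v i c) else (case f j of (i, c) \<Rightarrow> v i c))
        (Pi_pmf I (0, False) (\<lambda>_. pair_pmf (U m) coin))) A"
      unfolding P0_def I_def by (rule emeasure_data_law_distr_pmf[OF \<open>n1 \<ge> 1\<close> A])
    also have "(\<lambda>f. \<lambda>j\<in>I. if j \<le> n1 then (case f j of (i, c) \<Rightarrow> v i c) else (case f j of (i, c) \<Rightarrow> v i c))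
        = (\<lambda>f. \<lambda>j\<in>I. v (fst (f j)) (snd (f j)))" by (auto simp: split_beta)
    also have "map_pmf (\<lambda>f. \<lambda>j\<in>I. v (fst (f j)) (snd (f j))) (Pi_pmf I (0, False) (\<lambda>_. pair_pmf (U m) coin))
        = bind_pmf F (\<lambda>f. map_pmf (X f) (Pi_pmf I False (\<lambda>_. coin)))"
      unfolding Pi_pmf_pair_pmf[OF \<open>finite I\<close>] map_bind_pmf map_pmf_comp F_def
      by (intro bind_pmf_cong map_pmf_cong refl) (auto simp: X_def)
    finally show ?thesis by (simp only: emeasure_bind_pmf)
  qed
  have "emeasure (bind_pmf S (\<lambda>s. map_pmf (\<lambda>f. X f (T f s)) F)) A \<le> b"
  proof -
    have "emeasure (map_pmf (\<lambda>f. X f (T f s)) F) A \<le> b" for s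
    proof -
      have "(\<lambda>f. \<lambda>j\<in>I. if j \<le> n1 then v (f j) (s (f j)) else v (f j) (\<not> s (f j))) = (\<lambda>f. X f (T f s))"
        by (auto simp: X_def T_def fun_eq_iff restrict_def not_less)
      then show ?thesis
        using bound[of s] emeasure_data_law_distr_pmf[OF \<open>n1 \<ge> 1\<close> A, of "U m" "\<lambda>i. v i (s i)" "\<lambda>i. v i (\<not> s i)" 0]
        by (simp only: I_def[symmetric] F_def)
    qed
    then have "(\<integral>\<^sup>+s. emeasure (map_pmf (\<lambda>f. X f (T f s)) F) A \<partial>S) \<le> (\<integral>\<^sup>+s. b \<partial>S)"
      by (intro nn_integral_mono)
    then show ?thesis
      unfolding emeasure_bind_pmf by (simp add: measure_pmf.emeasure_space_1[simplified])
  qed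
  also have "bind_pmf S (\<lambda>s. map_pmf (\<lambda>f. X f (T f s)) F) = bind_pmf F (\<lambda>f. map_pmf (\<lambda>s. X f (T f s)) S)"
    unfolding map_pmf_def by (rule bind_commute_pmf)
  finally have mix: "(\<integral>\<^sup>+f. emeasure (map_pmf (\<lambda>s. X f (T f s)) S) A \<partial>F) \<le> b"
    by (simp only: emeasure_bind_pmf)
  have "(\<integral>\<^sup>+f. emeasure (map_pmf (X f) (Pi_pmf I False (\<lambda>_. coin))) A \<partial>F)
      \<le> (\<integral>\<^sup>+f. emeasure (map_pmf (\<lambda>s. X f (T f s)) S) A + indicator {f. \<not> inj_on f I} f \<partial>F)"
  proof (rule nn_integral_mono_AE, subst AE_measure_pmf_iff, intro ballI)
    fix f assume f: "f \<in> set_pmf F"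
    show "emeasure (map_pmf (X f) (Pi_pmf I False (\<lambda>_. coin))) A
        \<le> emeasure (map_pmf (\<lambda>s. X f (T f s)) S) A + indicator {f. \<not> inj_on f I} f"
    proof (cases "inj_on f I")
      case True
      have "map_pmf (T f) S = Pi_pmf I False (\<lambda>_. coin)"
        unfolding S_def T_def[abs_def] coin_def
        by (rule fresh_coins[OF \<open>finite I\<close> _ True F_range[OF f]]) simp
      then have "map_pmf (X f) (Pi_pmf I False (\<lambda>_. coin)) = map_pmf (\<lambda>s. X f (T f s)) S"
        by (simp add: map_pmf_comp flip: \<open>map_pmf (T f) S = _\<close>)
      then show ?thesis by (simp only:) (simp add: add_increasing2)
    next
      case False
      then show ?thesis
        using measure_pmf.emeasure_le_1[of "map_pmf (X f) (Pi_pmf I False (\<lambda>_. coin))" A]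
        by (auto intro: order_trans add_increasing simp del: emeasure_map_pmf)
    qed
  qed
  also have "\<dots> = (\<integral>\<^sup>+f. emeasure (map_pmf (\<lambda>s. X f (T f s)) S) A \<partial>F) + emeasure (measure_pmf F) {f. \<not> inj_on f I}"
    by (subst nn_integral_add) auto
  also have "\<dots> \<le> b + ennreal ((real (n1 + n2))\<^sup>2 / m)"
  proof (intro add_mono mix)
    have "measure_pmf.prob F {f. \<not> inj_on f I} \<le> (real (n1 + n2))\<^sup>2 / m"
      using prob_collision_le[OF \<open>finite I\<close> \<open>m > 0\<close>, of 0] by (simp add: F_def U_def I_def)
    then show "emeasure (measure_pmf F) {f. \<not> inj_on f I} \<le> ennreal ((real (n1 + n2))\<^sup>2 / m)"
      by (simp add: measure_pmf.emeasure_eq_measure ennreal_leI)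
  qed
  finally show ?thesis unfolding null .
qed

text \<open>If the rate of a level-\<open>\<alpha>\<close> test were below \<open>1\<close>, the test would accept with probability at most \<open>\<beta>\<close>
  under each of the coin-toss alternatives, hence with probability at most \<open>\<beta> + n\<^sup>2/m\<close> under a null
  law. It rejects there with probability at most \<open>\<alpha>\<close>, and for large \<open>m\<close> these add up to less than \<open>1\<close>.\<close>

lemma minimax_rate_ge_1:
  assumes infinite_dim: "\<And>S :: 'a::{real_inner, polish_space} set. finite S \<Longrightarrow> span S \<noteq> UNIV"
    and "n1 \<ge> 1" and \<alpha>: "\<alpha> > 0" and \<beta>: "\<beta> > 0" and \<alpha>\<beta>: "\<alpha> + \<beta> < 1"
  shows "minimax_rate TYPE('a) n1 n2 \<alpha> \<beta> \<ge> 1"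
proof -
  have *: "1 \<le> ereal \<rho>"
    if \<psi>: "\<psi> \<in> level_tests n1 n2 \<alpha>"
      and \<rho>: "(SUP \<nu> \<in> weighting_measures. SUP (P, Q) \<in> alternatives \<nu> \<rho>. test_error n1 n2 \<psi> P Q) \<le> ennreal \<beta>"
    for \<psi> :: "(nat \<Rightarrow> 'a) \<Rightarrow> nat" and \<rho>
  proof (rule ccontr)
    assume "\<not> 1 \<le> ereal \<rho>"
    then have "\<rho> \<le> 2" by (simp add: one_ereal_def)
    define n where "n = real (n1 + n2)"
    obtain m :: nat where m: "m > n\<^sup>2 / (1 - \<alpha> - \<beta>)" using reals_Archimedean2 by blast
    moreover have "n\<^sup>2 / (1 - \<alpha> - \<beta>) \<ge> 0" using \<alpha>\<beta> by simp
    ultimately have "m > 0" by linarith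
    have small: "n\<^sup>2 / m < 1 - \<alpha> - \<beta>"
      using m \<open>m > 0\<close> \<alpha>\<beta> by (simp add: field_simps)
    obtain e :: "nat \<Rightarrow> 'a" where e: "\<And>i j. i < 2 * m \<Longrightarrow> j < 2 * m \<Longrightarrow> e i \<bullet> e j = (if i = j then 1 else 0)"
      using orthonormal_family_exists[OF infinite_dim, of "2 * m"] by blast
    \<comment> \<open>Pair \<open>i\<close> consists of the vectors with indices \<open>2 i\<close> and \<open>2 i + 1\<close>.\<close>
    define v where "v i c = e (2 * i + of_bool c)" for i c
    have v: "v i b \<bullet> v j c = (if i = j \<and> b = c then 1 else 0)" if "i < m" "j < m" for i j b c
    proof -
      have "2 * i + of_bool b < 2 * m" "2 * j + of_bool c < 2 * m"
        using that by (cases b; cases c; simp)+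
      moreover have "2 * i + of_bool b = 2 * j + of_bool c \<longleftrightarrow> i = j \<and> b = c"
        by (cases b; cases c; simp; presburger)
      ultimately show ?thesis by (simp add: v_def e)
    qed
    define I where "I = {1..n1 + n2}"
    let ?B = "PiM I (\<lambda>_. borel :: 'a measure)"
    have \<psi>_meas: "\<psi> \<in> measurable ?B (count_space {0, 1})"
      using \<psi> by (simp add: level_tests_def tests_def I_def)
    have sets_D: "sets (data_law n1 n2 P Q) = sets ?B"
      if "P \<in> borel_prob" "Q \<in> borel_prob" for P Q :: "'a measure"
      unfolding data_law_def I_def using borel_probD(2) that by (intro sets_PiM_cong) auto
    note space_D = sets_eq_imp_space_eq[OF sets_D]
    define A where "A = {z \<in> space ?B. \<psi> z = 0}"
    define A1 where "A1 = {z \<in> space ?B. \<psi> z = 1}"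
    have "A = \<psi> -` {0} \<inter> space ?B" "A1 = \<psi> -` {1} \<inter> space ?B" by (auto simp: A_def A1_def)
    then have A: "A \<in> sets ?B" "A1 \<in> sets ?B" using measurable_sets[OF \<psi>_meas] by auto
    have A_Un: "A \<union> A1 = space ?B"
      using measurable_space[OF \<psi>_meas] by (auto simp: A_def A1_def)
    define U where "U = pmf_of_set {..<m}"
    define P0 where "P0 = distr (measure_pmf (pair_pmf U (bernoulli_pmf (1 / 2)))) borel (\<lambda>(i, c). v i c)"
    have P0: "P0 \<in> borel_prob" unfolding P0_def by (rule borel_prob_distr_pmf)
    have "emeasure (data_law n1 n2 P0 P0) A \<le> ennreal \<beta> + ennreal ((real (n1 + n2))\<^sup>2 / m)"
      unfolding P0_def U_def
    proof (rule data_law_null_le_mixture[OF \<open>n1 \<ge> 1\<close> \<open>m > 0\<close> A(1)[unfolded I_def]])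
      fix s
      let ?P = "distr (measure_pmf (pmf_of_set {..<m})) borel (\<lambda>i. v i (s i))"
      let ?Q = "distr (measure_pmf (pmf_of_set {..<m})) borel (\<lambda>i. v i (\<not> s i))"
      obtain \<nu> where \<nu>: "\<nu> \<in> weighting_measures" "(?P, ?Q) \<in> alternatives \<nu> \<rho>"
        using orthonormal_halves_in_alternatives[OF v \<open>m > 0\<close> \<open>\<rho> \<le> 2\<close>] by blast
      have "emeasure (data_law n1 n2 ?P ?Q) A = test_error n1 n2 \<psi> ?P ?Q"
        by (simp add: test_error_def A_def space_D borel_prob_distr_pmf)
      also have "\<dots> \<le> (SUP (P, Q) \<in> alternatives \<nu> \<rho>. test_error n1 n2 \<psi> P Q)"
        using \<nu>(2) by (auto intro: SUP_upper2)
      also have "\<dots> \<le> (SUP \<nu> \<in> weighting_measures. SUP (P, Q) \<in> alternatives \<nu> \<rho>. test_error n1 n2 \<psi> P Q)"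
        using \<nu>(1) by (rule SUP_upper)
      also note \<rho>
      finally show "emeasure (data_law n1 n2 ?P ?Q) A \<le> ennreal \<beta>" .
    qed
    moreover have "emeasure (data_law n1 n2 P0 P0) A1 \<le> ennreal \<alpha>"
    proof -
      have "emeasure (data_law n1 n2 P0 P0) A1
          = emeasure (data_law n1 n2 P0 P0) {z \<in> space (data_law n1 n2 P0 P0). \<psi> z = 1}"
        by (simp add: A1_def space_D P0)
      also have "\<dots> \<le> (SUP P \<in> borel_prob.
           emeasure (data_law n1 n2 P P) {z \<in> space (data_law n1 n2 P P). \<psi> z = 1})"
        using P0 by (rule SUP_upper)
      also have "\<dots> \<le> ennreal \<alpha>" using \<psi> by (simp add: level_tests_def)
      finally show ?thesis .
    qed
    ultimately have "emeasure (data_law n1 n2 P0 P0) A + emeasure (data_law n1 n2 P0 P0) A1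
        \<le> ennreal \<beta> + ennreal (n\<^sup>2 / m) + ennreal \<alpha>"
      unfolding n_def by (rule add_mono)
    also have "\<dots> = ennreal (\<beta> + n\<^sup>2 / m + \<alpha>)"
      using \<alpha> \<beta> by simp
    also have "\<dots> < 1" using small by (subst ennreal_less_one_iff) linarith
    finally have "emeasure (data_law n1 n2 P0 P0) A + emeasure (data_law n1 n2 P0 P0) A1 < 1" .
    moreover have "emeasure (data_law n1 n2 P0 P0) (A \<union> A1)
        \<le> emeasure (data_law n1 n2 P0 P0) A + emeasure (data_law n1 n2 P0 P0) A1"
      using A sets_D[OF P0 P0] by (intro emeasure_subadditive) auto
    moreover have "emeasure (data_law n1 n2 P0 P0) (A \<union> A1) = 1"
    proof -
      interpret prob_space "data_law n1 n2 P0 P0"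
        unfolding data_law_def using borel_probD(1)[OF P0] by (intro prob_space_PiM) auto
      show ?thesis unfolding A_Un space_D[OF P0 P0, symmetric] by (rule emeasure_space_1)
    qed
    ultimately show False by (metis leD)
  qed
  show ?thesis
    unfolding minimax_rate_def separation_rate_def
    by (intro INF_greatest) (rule *, assumption, simp)
qed

section \<open>The two separation rates\<close>

text \<open>The lower bound holds with \<open>c' = 1\<close>: the minimax rate is at least \<open>1\<close>, and
  \<open>(n1 + n2) powr (-1/2)\<close> never exceeds \<open>1\<close>.\<close>

theorem theorem4p8:
  assumes infinite_dim: "\<And>S :: 'a::{real_inner, polish_space} set. finite S \<Longrightarrow> span S \<noteq> UNIV"
  shows
    "(\<forall>c1 > 0. \<forall>c2 > 0. \<exists>c > 0. \<forall>(n1::nat) \<ge> 1. \<forall>(n2::nat) \<ge> 1. \<forall>\<alpha> \<beta> :: real. \<forall>B :: nat.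
        c1 \<le> real n1 / real n2 \<and> real n1 / real n2 \<le> c2 \<and>
        0 < \<alpha> \<and> \<alpha> < 1 \<and> 0 < \<beta> \<and> \<beta> < 1 \<and> 0 < \<alpha> + \<beta> \<and> \<alpha> + \<beta> < 1 \<and>
        \<beta> < 1 / exp 1 \<and> real B \<ge> 2 * \<alpha> powi (-2) * ln (6 / \<beta>) \<longrightarrow>
        separation_rate
          (perm_test_error n1 n2 B \<alpha> :: 'a measure \<Rightarrow> 'a measure \<Rightarrow> 'a measure \<Rightarrow> ennreal) \<beta>
        \<le> ereal (c * real (n1 + n2) powr (- 1 / 2) * (ln (1 / \<alpha>) + ln (1 / \<beta>))))
     \<and>
     (\<exists>c' > 0. \<forall>(n1::nat) \<ge> 1. \<forall>(n2::nat) \<ge> 1. \<forall>\<alpha> \<beta> :: real.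
        0 < \<alpha> \<and> \<alpha> < 1 \<and> 0 < \<beta> \<and> \<beta> < 1 \<and> 0 < \<alpha> + \<beta> \<and> \<alpha> + \<beta> < 1 \<longrightarrow>
        minimax_rate TYPE('a) n1 n2 \<alpha> \<beta> \<ge> ereal (c' * real (n1 + n2) powr (- 1 / 2)))"
proof (intro conjI allI impI)
  fix c1 c2 :: real assume "c1 > 0" "c2 > 0"
  then show "\<exists>c > 0. \<forall>(n1::nat) \<ge> 1. \<forall>(n2::nat) \<ge> 1. \<forall>\<alpha> \<beta> :: real. \<forall>B :: nat.
        c1 \<le> real n1 / real n2 \<and> real n1 / real n2 \<le> c2 \<and>
        0 < \<alpha> \<and> \<alpha> < 1 \<and> 0 < \<beta> \<and> \<beta> < 1 \<and> 0 < \<alpha> + \<beta> \<and> \<alpha> + \<beta> < 1 \<and>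
        \<beta> < 1 / exp 1 \<and> real B \<ge> 2 * \<alpha> powi (-2) * ln (6 / \<beta>) \<longrightarrow>
        separation_rate
          (perm_test_error n1 n2 B \<alpha> :: 'a measure \<Rightarrow> 'a measure \<Rightarrow> 'a measure \<Rightarrow> ennreal) \<beta>
        \<le> ereal (c * real (n1 + n2) powr (- 1 / 2) * (ln (1 / \<alpha>) + ln (1 / \<beta>)))"
    by (intro exI[of _ "72 * (1 + 1 / c1 + c2)"] conjI allI impI, simp add: add_pos_pos)
       (elim conjE, rule separation_rate_perm_test_le)
next
  have "ereal (1 * real (n1 + n2) powr (- 1 / 2)) \<le> minimax_rate TYPE('a) n1 n2 \<alpha> \<beta>"
    if "n1 \<ge> 1" "0 < \<alpha>" "0 < \<beta>" "\<alpha> + \<beta> < 1" for n1 n2 :: nat and \<alpha> \<beta> :: real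
  proof -
    have "real (n1 + n2) powr (- 1 / 2) \<le> real (n1 + n2) powr 0"
      using that by (intro powr_mono) auto
    then have "ereal (1 * real (n1 + n2) powr (- 1 / 2)) \<le> 1"
      using that by (simp add: one_ereal_def)
    also have "\<dots> \<le> minimax_rate TYPE('a) n1 n2 \<alpha> \<beta>"
      using that by (intro minimax_rate_ge_1 infinite_dim)
    finally show ?thesis .
  qed
  then show "\<exists>c' > 0. \<forall>(n1::nat) \<ge> 1. \<forall>(n2::nat) \<ge> 1. \<forall>\<alpha> \<beta> :: real.
        0 < \<alpha> \<and> \<alpha> < 1 \<and> 0 < \<beta> \<and> \<beta> < 1 \<and> 0 < \<alpha> + \<beta> \<and> \<alpha> + \<beta> < 1 \<longrightarrow>
        minimax_rate TYPE('a) n1 n2 \<alpha> \<beta> \<ge> ereal (c' * real (n1 + n2) powr (- 1 / 2))"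
    by (intro exI[of _ 1]) simp
qed

end
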